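(* Let $\kappa$ be a commutative unital ring, $A$ a unital $\kappa$-algebra and $H$ a Hopf $\kappa$-algebra with two symmetric twisted partial actions on $A$, $h\otimes a\mapsto h\cdot a$ with cocycle $\omega$, and $h\otimes a\mapsto h\bullet a$ with cocycle $\sigma$. Let $A\#_\omega H$ and $A\#_\sigma H$ be the corresponding partial crossed products. Suppose that there is an algebra isomorphism $\Phi:A\#_\omega H\to A\#_\sigma H$ which is also a left $A$-module and right $H$-comodule map. Then there exist linear maps $u,v\in\mathrm{Hom}(H,A)$ such that, for all $h,k\in H$, $a\in A$, (i) $(u*v)(h)=h\cdot\mathbf 1_A$; (ii) $u(h)=\sum u(h_{(1)})(h_{(2)}\cdot\mathbf 1_A)=\sum(h_{(1)}\cdot\mathbf 1_A)u(h_{(2)})$; (iii) $h\bullet a=\sum v(h_{(1)})(h_{(2)}\cdot a)u(h_{(3)})$; (iv) $\sigma(h,k)=\sum v(h_{(1)})(h_{(2)}\cdot v(k_{(1)}))\,\omega(h_{(3)},k_{(2)})\,u(h_{(4)}k_{(3)})$; (v) $\Phi(a\#_\omega h)=\sum a\,u(h_{(1)})\#_\sigma h_{(2)}$. Conversely, given maps $u,v\in\mathrm{Hom}(H,A)$ satisfying (i), (ii), (iii) and (iv), and in addition $u(1_H)=v(1_H)=\mathbf 1_A$, the map $\Phi:A\#_\omega H\to A\#_\sigma H$ given by the formula in (v) is an isomorphism of algebras.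
   Context: All tensor products and $\mathrm{Hom}$ are over the commutative unital ring $\kappa$; Sweedler notation is used; $\mathrm{Hom}(H,A)$ and $\mathrm{Hom}(H\otimes H,A)$ carry the convolution product $*$. A twisted partial action of $H$ on a unital algebra $A$ (unit $\mathbf 1_A$) is a pair of $\kappa$-linear maps $\alpha:H\otimes A\to A$, $\alpha(h\otimes a)=h\cdot a$, and $\omega:H\otimes H\to A$ such that for all $a,b\in A$, $h,l\in H$: $1_H\cdot a=a$; $h\cdot(ab)=\sum(h_{(1)}\cdot a)(h_{(2)}\cdot b)$; $\sum(h_{(1)}\cdot(l_{(1)}\cdot a))\omega(h_{(2)},l_{(2)})=\sum\omega(h_{(1)},l_{(1)})(h_{(2)}l_{(2)}\cdot a)$; $\omega(h,l)=\sum\omega(h_{(1)},l_{(1)})(h_{(2)}l_{(2)}\cdot\mathbf 1_A)$. Let $f_1(h\otimes k)=(h\cdot\mathbf 1_A)\varepsilon(k)$ and $f_2(h\otimes k)=hk\cdot\mathbf 1_A$; these are convolution idempotents in $\mathrm{Hom}(H\otimes H,A)$. The twisted partial action is symmetric if: (1) $f_1,f_2$ are central in $\mathrm{Hom}(H\otimes H,A)$; (2) $\omega$ satisfies $\omega(h,1_H)=\omega(1_H,h)=h\cdot\mathbf 1_A$ and $\sum(h_{(1)}\cdot\omega(l_{(1)},m_{(1)}))\omega(h_{(2)},l_{(2)}m_{(2)})=\sum\omega(h_{(1)},l_{(1)})\omega(h_{(2)}l_{(2)},m)$ for all $h,l,m\in H$, and $\omega$ is an invertible element of the ideal $\langle f_1*f_2\rangle$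 of $\mathrm{Hom}(H\otimes H,A)$ generated by $f_1*f_2$ (which has unit $f_1*f_2$), i.e. there is $\omega'\in\langle f_1*f_2\rangle$ with $\omega*\omega'=\omega'*\omega=f_1*f_2$; (3) $h\cdot(k\cdot\mathbf 1_A)=\sum(h_{(1)}\cdot\mathbf 1_A)(h_{(2)}k\cdot\mathbf 1_A)$ for all $h,k\in H$. Partial crossed product: on $A\otimes H$ put the multiplication $(a\otimes h)(b\otimes l)=\sum a(h_{(1)}\cdot b)\omega(h_{(2)},l_{(1)})\otimes h_{(3)}l_{(2)}$. Then $A\#_\omega H=(A\otimes H)(\mathbf 1_A\otimes 1_H)$ is the $\kappa$-submodule spanned by the elements $a\#_\omega h:=\sum a(h_{(1)}\cdot\mathbf 1_A)\otimes h_{(2)}$; under the conditions above it is an associative algebra with unit $\mathbf 1_A\#_\omega 1_H$. $A\#_\sigma H$ is defined in the same way from $\bullet$ and $\sigma$. The left $A$-module structure on a crossed product is $a\blacktriangleright(b\#h)=(a\#1_H)(b\#h)=ab\#h$ and the right $H$-comodule structure is the restriction of $I_A\otimes\Delta$. *)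

theory Defs
  imports Complex_Main "HOL-Library.Poly_Mapping"
begin

section \<open>Tensor products over a commutative ring\<close>

text \<open>
  Modules over a commutative ring are given as in \<open>HOL.Modules\<close>, by a type together with a
  scalar multiplication. A tensor product is the free abelian group on the tuples modulo the
  subgroup generated by the usual relations; its elements are cosets, and every element is a finite
  sum of pure tensors, which we present as a list of tuples.
\<close>

type_synonym ('m, 'n) tensor2 = "(('m \<times> 'n) \<Rightarrow>\<^sub>0 int) set"
type_synonym ('l, 'm, 'n) tensor3 = "(('l \<times> 'm \<times> 'n) \<Rightarrow>\<^sub>0 int) set"

definition formal_sum :: "'x list \<Rightarrow> 'x \<Rightarrow>\<^sub>0 int" where
  "formal_sum xs = (\<Sum>x\<leftarrow>xs. frag_of x)"

inductive_set null2 ::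
    "('k::comm_ring_1 \<Rightarrow> 'm::ab_group_add \<Rightarrow> 'm) \<Rightarrow> ('k \<Rightarrow> 'n::ab_group_add \<Rightarrow> 'n)
      \<Rightarrow> (('m \<times> 'n) \<Rightarrow>\<^sub>0 int) set"
  for sM sN where
  zero: "0 \<in> null2 sM sN"
| diff: "p \<in> null2 sM sN \<Longrightarrow> q \<in> null2 sM sN \<Longrightarrow> p - q \<in> null2 sM sN"
| add_left: "frag_of (m + m', n) - frag_of (m, n) - frag_of (m', n) \<in> null2 sM sN"
| add_right: "frag_of (m, n + n') - frag_of (m, n) - frag_of (m, n') \<in> null2 sM sN"
| scale: "frag_of (sM c m, n) - frag_of (m, sN c n) \<in> null2 sM sN"

inductive_set null3 ::
    "('k::comm_ring_1 \<Rightarrow> 'l::ab_group_add \<Rightarrow> 'l) \<Rightarrow> ('k \<Rightarrow> 'm::ab_group_add \<Rightarrow> 'm)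
      \<Rightarrow> ('k \<Rightarrow> 'n::ab_group_add \<Rightarrow> 'n) \<Rightarrow> (('l \<times> 'm \<times> 'n) \<Rightarrow>\<^sub>0 int) set"
  for sL sM sN where
  zero: "0 \<in> null3 sL sM sN"
| diff: "p \<in> null3 sL sM sN \<Longrightarrow> q \<in> null3 sL sM sN \<Longrightarrow> p - q \<in> null3 sL sM sN"
| add1: "frag_of (l + l', m, n) - frag_of (l, m, n) - frag_of (l', m, n) \<in> null3 sL sM sN"
| add2: "frag_of (l, m + m', n) - frag_of (l, m, n) - frag_of (l, m', n) \<in> null3 sL sM sN"
| add3: "frag_of (l, m, n + n') - frag_of (l, m, n) - frag_of (l, m, n') \<in> null3 sL sM sN"
| scale12: "frag_of (sL c l, m, n) - frag_of (l, sM c m, n) \<in> null3 sL sM sN"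
| scale23: "frag_of (l, sM c m, n) - frag_of (l, m, sN c n) \<in> null3 sL sM sN"

text \<open>
  \<open>tens2 sM sN [(m1, n1), \<dots>, (mr, nr)]\<close> is the element \<open>m1 \<otimes> n1 + \<dots> + mr \<otimes> nr\<close>. The lists cover
  the whole tensor product, because \<open>- (m \<otimes> n) = (- m) \<otimes> n\<close>.
\<close>

definition tens2 ::
    "('k::comm_ring_1 \<Rightarrow> 'm::ab_group_add \<Rightarrow> 'm) \<Rightarrow> ('k \<Rightarrow> 'n::ab_group_add \<Rightarrow> 'n)
      \<Rightarrow> ('m \<times> 'n) list \<Rightarrow> ('m, 'n) tensor2" where
  "tens2 sM sN xs = {p. p - formal_sum xs \<in> null2 sM sN}"

definition tens3 ::
    "('k::comm_ring_1 \<Rightarrow> 'l::ab_group_add \<Rightarrow> 'l) \<Rightarrow> ('k \<Rightarrow> 'm::ab_group_add \<Rightarrow> 'm)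
      \<Rightarrow> ('k \<Rightarrow> 'n::ab_group_add \<Rightarrow> 'n) \<Rightarrow> ('l \<times> 'm \<times> 'n) list \<Rightarrow> ('l, 'm, 'n) tensor3" where
  "tens3 sL sM sN xs = {p. p - formal_sum xs \<in> null3 sL sM sN}"

text \<open>
  A chosen presentation of a tensor as a sum of pure tensors. It is used only inside expressions
  which are additive and balanced in the tuples, so the choice does not matter.
\<close>

definition pres2 ::
    "('k::comm_ring_1 \<Rightarrow> 'm::ab_group_add \<Rightarrow> 'm) \<Rightarrow> ('k \<Rightarrow> 'n::ab_group_add \<Rightarrow> 'n)
      \<Rightarrow> ('m, 'n) tensor2 \<Rightarrow> ('m \<times> 'n) list" where
  "pres2 sM sN X = (SOME xs. tens2 sM sN xs = X)"

definition tensor_space ::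
    "('k::comm_ring_1 \<Rightarrow> 'm::ab_group_add \<Rightarrow> 'm) \<Rightarrow> ('k \<Rightarrow> 'n::ab_group_add \<Rightarrow> 'n)
      \<Rightarrow> ('m, 'n) tensor2 set" where
  "tensor_space sM sN = range (tens2 sM sN)"

definition tens_sum ::
    "('k::comm_ring_1 \<Rightarrow> 'm::ab_group_add \<Rightarrow> 'm) \<Rightarrow> ('k \<Rightarrow> 'n::ab_group_add \<Rightarrow> 'n)
      \<Rightarrow> ('m, 'n) tensor2 list \<Rightarrow> ('m, 'n) tensor2" where
  "tens_sum sM sN Xs = tens2 sM sN (concat (map (pres2 sM sN) Xs))"

definition tens_scale ::
    "('k::comm_ring_1 \<Rightarrow> 'm::ab_group_add \<Rightarrow> 'm) \<Rightarrow> ('k \<Rightarrow> 'n::ab_group_add \<Rightarrow> 'n)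
      \<Rightarrow> 'k \<Rightarrow> ('m, 'n) tensor2 \<Rightarrow> ('m, 'n) tensor2" where
  "tens_scale sM sN c X = tens2 sM sN [(sM c m, n). (m, n) \<leftarrow> pres2 sM sN X]"

section \<open>Algebras and Hopf algebras\<close>

text \<open>
  The sort \<open>{ring, monoid_mult}\<close> is that of associative unital rings, the zero ring included
  (\<open>ring_1\<close> would exclude it).
\<close>

locale unital_algebra = module scale
  for scale :: "'k::comm_ring_1 \<Rightarrow> 'a::{ring, monoid_mult} \<Rightarrow> 'a" +
  assumes scale_mult_left: "scale c x * y = scale c (x * y)"
    and scale_mult_right: "x * scale c y = scale c (x * y)"

text \<open>
  Sweedler notation: \<open>cop2 s \<Delta> h\<close> lists the pairs \<open>(h\<^sub>1, h\<^sub>2)\<close> of a presentation of \<open>\<Delta> h\<close>, so that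
  a Sweedler sum is a sum over that list; \<open>cop3\<close> and \<open>cop4\<close> iterate \<open>\<Delta>\<close> in the last tensor factor.
\<close>

definition cop2 ::
    "('k::comm_ring_1 \<Rightarrow> 'h::ab_group_add \<Rightarrow> 'h) \<Rightarrow> ('h \<Rightarrow> ('h, 'h) tensor2) \<Rightarrow> 'h
      \<Rightarrow> ('h \<times> 'h) list" where
  "cop2 s \<Delta> h = pres2 s s (\<Delta> h)"

definition cop3 ::
    "('k::comm_ring_1 \<Rightarrow> 'h::ab_group_add \<Rightarrow> 'h) \<Rightarrow> ('h \<Rightarrow> ('h, 'h) tensor2) \<Rightarrow> 'h
      \<Rightarrow> ('h \<times> 'h \<times> 'h) list" where
  "cop3 s \<Delta> h = [(h1, h2, h3). (h1, x) \<leftarrow> cop2 s \<Delta> h, (h2, h3) \<leftarrow> cop2 s \<Delta> x]"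

definition cop4 ::
    "('k::comm_ring_1 \<Rightarrow> 'h::ab_group_add \<Rightarrow> 'h) \<Rightarrow> ('h \<Rightarrow> ('h, 'h) tensor2) \<Rightarrow> 'h
      \<Rightarrow> ('h \<times> 'h \<times> 'h \<times> 'h) list" where
  "cop4 s \<Delta> h = [(h1, h2, h3, h4). (h1, x) \<leftarrow> cop2 s \<Delta> h, (h2, h3, h4) \<leftarrow> cop3 s \<Delta> x]"

locale hopf_algebra = unital_algebra s
  for s :: "'k::comm_ring_1 \<Rightarrow> 'h::{ring, monoid_mult} \<Rightarrow> 'h" +
  fixes \<Delta> :: "'h \<Rightarrow> ('h, 'h) tensor2" and \<epsilon> :: "'h \<Rightarrow> 'k" and S :: "'h \<Rightarrow> 'h"
  assumes comult_closed: "\<Delta> h \<in> tensor_space s s"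
    and comult_add: "\<Delta> (h + l) = tens_sum s s [\<Delta> h, \<Delta> l]"
    and comult_scale: "\<Delta> (s c h) = tens_scale s s c (\<Delta> h)"
    and coassoc:
      "tens3 s s s [(h1, h2, h3). (x, h3) \<leftarrow> cop2 s \<Delta> h, (h1, h2) \<leftarrow> cop2 s \<Delta> x] =
       tens3 s s s [(h1, h2, h3). (h1, x) \<leftarrow> cop2 s \<Delta> h, (h2, h3) \<leftarrow> cop2 s \<Delta> x]"
    and counit_linear: "module_hom s (*) \<epsilon>"
    and counit_left: "(\<Sum>(h1, h2)\<leftarrow>cop2 s \<Delta> h. s (\<epsilon> h1) h2) = h"
    and counit_right: "(\<Sum>(h1, h2)\<leftarrow>cop2 s \<Delta> h. s (\<epsilon> h2) h1) = h"
    and comult_mult: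
      "\<Delta> (h * l) =
        tens2 s s [(h1 * l1, h2 * l2). (h1, h2) \<leftarrow> cop2 s \<Delta> h, (l1, l2) \<leftarrow> cop2 s \<Delta> l]"
    and comult_one: "\<Delta> 1 = tens2 s s [(1, 1)]"
    and counit_mult: "\<epsilon> (h * l) = \<epsilon> h * \<epsilon> l"
    and counit_one: "\<epsilon> 1 = 1"
    and antipode_linear: "module_hom s s S"
    and antipode_left: "(\<Sum>(h1, h2)\<leftarrow>cop2 s \<Delta> h. S h1 * h2) = s (\<epsilon> h) 1"
    and antipode_right: "(\<Sum>(h1, h2)\<leftarrow>cop2 s \<Delta> h. h1 * S h2) = s (\<epsilon> h) 1"

section \<open>Convolution\<close>

text \<open>Linear maps out of a tensor product of two modules are represented by bilinear maps.\<close>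

definition bilinear_map ::
    "('k::comm_ring_1 \<Rightarrow> 'm::ab_group_add \<Rightarrow> 'm) \<Rightarrow> ('k \<Rightarrow> 'n::ab_group_add \<Rightarrow> 'n)
      \<Rightarrow> ('k \<Rightarrow> 'p::ab_group_add \<Rightarrow> 'p) \<Rightarrow> ('m \<Rightarrow> 'n \<Rightarrow> 'p) \<Rightarrow> bool" where
  "bilinear_map sM sN sP f \<longleftrightarrow>
    (\<forall>x. module_hom sN sP (f x)) \<and> (\<forall>y. module_hom sM sP (\<lambda>x. f x y))"

definition conv ::
    "('k::comm_ring_1 \<Rightarrow> 'h::ab_group_add \<Rightarrow> 'h) \<Rightarrow> ('h \<Rightarrow> ('h, 'h) tensor2)
      \<Rightarrow> ('h \<Rightarrow> 'a::ring) \<Rightarrow> ('h \<Rightarrow> 'a) \<Rightarrow> 'h \<Rightarrow> 'a" where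
  "conv s \<Delta> f g h = (\<Sum>(h1, h2)\<leftarrow>cop2 s \<Delta> h. f h1 * g h2)"

definition conv2 ::
    "('k::comm_ring_1 \<Rightarrow> 'h::ab_group_add \<Rightarrow> 'h) \<Rightarrow> ('h \<Rightarrow> ('h, 'h) tensor2)
      \<Rightarrow> ('h \<Rightarrow> 'h \<Rightarrow> 'a::ring) \<Rightarrow> ('h \<Rightarrow> 'h \<Rightarrow> 'a) \<Rightarrow> 'h \<Rightarrow> 'h \<Rightarrow> 'a" where
  "conv2 s \<Delta> f g h k =
    (\<Sum>(h1, h2)\<leftarrow>cop2 s \<Delta> h. \<Sum>(k1, k2)\<leftarrow>cop2 s \<Delta> k. f h1 k1 * g h2 k2)"

definition hom2 ::
    "('k::comm_ring_1 \<Rightarrow> 'h::ab_group_add \<Rightarrow> 'h) \<Rightarrow> ('k \<Rightarrow> 'a::ab_group_add \<Rightarrow> 'a)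
      \<Rightarrow> ('h \<Rightarrow> 'h \<Rightarrow> 'a) set" where
  "hom2 s sA = {f. bilinear_map s s sA f}"

definition central2 ::
    "('k::comm_ring_1 \<Rightarrow> 'h::ab_group_add \<Rightarrow> 'h) \<Rightarrow> ('h \<Rightarrow> ('h, 'h) tensor2)
      \<Rightarrow> ('k \<Rightarrow> 'a::ring \<Rightarrow> 'a) \<Rightarrow> ('h \<Rightarrow> 'h \<Rightarrow> 'a) \<Rightarrow> bool" where
  "central2 s \<Delta> sA f \<longleftrightarrow>
    f \<in> hom2 s sA \<and> (\<forall>g \<in> hom2 s sA. conv2 s \<Delta> f g = conv2 s \<Delta> g f)"

definition is_ideal2 ::
    "('k::comm_ring_1 \<Rightarrow> 'h::ab_group_add \<Rightarrow> 'h) \<Rightarrow> ('h \<Rightarrow> ('h, 'h) tensor2)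
      \<Rightarrow> ('k \<Rightarrow> 'a::ring \<Rightarrow> 'a) \<Rightarrow> ('h \<Rightarrow> 'h \<Rightarrow> 'a) set \<Rightarrow> bool" where
  "is_ideal2 s \<Delta> sA I \<longleftrightarrow>
    I \<subseteq> hom2 s sA \<and> (\<lambda>h k. 0) \<in> I \<and>
    (\<forall>f \<in> I. \<forall>g \<in> I. (\<lambda>h k. f h k - g h k) \<in> I) \<and>
    (\<forall>f \<in> I. \<forall>g \<in> hom2 s sA. conv2 s \<Delta> f g \<in> I \<and> conv2 s \<Delta> g f \<in> I)"

definition ideal2 ::
    "('k::comm_ring_1 \<Rightarrow> 'h::ab_group_add \<Rightarrow> 'h) \<Rightarrow> ('h \<Rightarrow> ('h, 'h) tensor2)
      \<Rightarrow> ('k \<Rightarrow> 'a::ring \<Rightarrow> 'a) \<Rightarrow> ('h \<Rightarrow> 'h \<Rightarrow> 'a) \<Rightarrow> ('h \<Rightarrow> 'h \<Rightarrow> 'a) set" where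
  "ideal2 s \<Delta> sA e = \<Inter>{I. is_ideal2 s \<Delta> sA I \<and> e \<in> I}"

section \<open>Symmetric twisted partial actions\<close>

locale twisted_partial_action = H: hopf_algebra s \<Delta> \<epsilon> S + A: unital_algebra sA
  for s :: "'k::comm_ring_1 \<Rightarrow> 'h::{ring, monoid_mult} \<Rightarrow> 'h"
    and \<Delta> :: "'h \<Rightarrow> ('h, 'h) tensor2" and \<epsilon> :: "'h \<Rightarrow> 'k" and S :: "'h \<Rightarrow> 'h"
    and sA :: "'k \<Rightarrow> 'a::{ring, monoid_mult} \<Rightarrow> 'a" +
  fixes act :: "'h \<Rightarrow> 'a \<Rightarrow> 'a" and \<omega> :: "'h \<Rightarrow> 'h \<Rightarrow> 'a"
  assumes act_bilinear: "bilinear_map s sA sA act"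
    and cocycle_bilinear: "bilinear_map s s sA \<omega>"
    and act_one: "act 1 a = a"
    and act_mult: "act h (a * b) = (\<Sum>(h1, h2)\<leftarrow>cop2 s \<Delta> h. act h1 a * act h2 b)"
    and act_twisted:
      "(\<Sum>(h1, h2)\<leftarrow>cop2 s \<Delta> h. \<Sum>(l1, l2)\<leftarrow>cop2 s \<Delta> l. act h1 (act l1 a) * \<omega> h2 l2) =
       (\<Sum>(h1, h2)\<leftarrow>cop2 s \<Delta> h. \<Sum>(l1, l2)\<leftarrow>cop2 s \<Delta> l. \<omega> h1 l1 * act (h2 * l2) a)"
    and cocycle_absorb:
      "\<omega> h l =
        (\<Sum>(h1, h2)\<leftarrow>cop2 s \<Delta> h. \<Sum>(l1, l2)\<leftarrow>cop2 s \<Delta> l. \<omega> h1 l1 * act (h2 * l2) 1)"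

definition f1 ::
    "('h \<Rightarrow> 'k) \<Rightarrow> ('k \<Rightarrow> 'a::{ring, monoid_mult} \<Rightarrow> 'a) \<Rightarrow> ('h \<Rightarrow> 'a \<Rightarrow> 'a)
      \<Rightarrow> 'h \<Rightarrow> 'h \<Rightarrow> 'a" where
  "f1 \<epsilon> sA act h k = sA (\<epsilon> k) (act h 1)"

definition f2 ::
    "('h::{ring, monoid_mult} \<Rightarrow> 'a::{ring, monoid_mult} \<Rightarrow> 'a) \<Rightarrow> 'h \<Rightarrow> 'h \<Rightarrow> 'a" where
  "f2 act h k = act (h * k) 1"

locale symmetric_twisted_partial_action = twisted_partial_action +
  assumes f1_central: "central2 s \<Delta> sA (f1 \<epsilon> sA act)"
    and f2_central: "central2 s \<Delta> sA (f2 act)"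
    and cocycle_one_right: "\<omega> h 1 = act h 1"
    and cocycle_one_left: "\<omega> 1 h = act h 1"
    and cocycle:
      "(\<Sum>(h1, h2)\<leftarrow>cop2 s \<Delta> h. \<Sum>(l1, l2)\<leftarrow>cop2 s \<Delta> l. \<Sum>(m1, m2)\<leftarrow>cop2 s \<Delta> m.
          act h1 (\<omega> l1 m1) * \<omega> h2 (l2 * m2)) =
       (\<Sum>(h1, h2)\<leftarrow>cop2 s \<Delta> h. \<Sum>(l1, l2)\<leftarrow>cop2 s \<Delta> l. \<omega> h1 l1 * \<omega> (h2 * l2) m)"
    and cocycle_in_ideal:
      "\<omega> \<in> ideal2 s \<Delta> sA (conv2 s \<Delta> (f1 \<epsilon> sA act) (f2 act))"
    and cocycle_invertible:
      "\<exists>\<omega>' \<in> ideal2 s \<Delta> sA (conv2 s \<Delta> (f1 \<epsilon> sA act) (f2 act)).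
        conv2 s \<Delta> \<omega> \<omega>' = conv2 s \<Delta> (f1 \<epsilon> sA act) (f2 act) \<and>
        conv2 s \<Delta> \<omega>' \<omega> = conv2 s \<Delta> (f1 \<epsilon> sA act) (f2 act)"
    and act_act_one: "act h (act k 1) = (\<Sum>(h1, h2)\<leftarrow>cop2 s \<Delta> h. act h1 1 * act (h2 * k) 1)"

section \<open>Partial crossed products\<close>

definition cp_mult ::
    "('k::comm_ring_1 \<Rightarrow> 'h::{ring, monoid_mult} \<Rightarrow> 'h) \<Rightarrow> ('h \<Rightarrow> ('h, 'h) tensor2)
      \<Rightarrow> ('k \<Rightarrow> 'a::{ring, monoid_mult} \<Rightarrow> 'a) \<Rightarrow> ('h \<Rightarrow> 'a \<Rightarrow> 'a) \<Rightarrow> ('h \<Rightarrow> 'h \<Rightarrow> 'a)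
      \<Rightarrow> ('a, 'h) tensor2 \<Rightarrow> ('a, 'h) tensor2 \<Rightarrow> ('a, 'h) tensor2" where
  "cp_mult s \<Delta> sA act \<omega> X Y =
    tens2 sA s [(a * act h1 b * \<omega> h2 l1, h3 * l2).
      (a, h) \<leftarrow> pres2 sA s X, (b, l) \<leftarrow> pres2 sA s Y,
      (h1, h2, h3) \<leftarrow> cop3 s \<Delta> h, (l1, l2) \<leftarrow> cop2 s \<Delta> l]"

definition cp_space ::
    "('k::comm_ring_1 \<Rightarrow> 'h::{ring, monoid_mult} \<Rightarrow> 'h) \<Rightarrow> ('h \<Rightarrow> ('h, 'h) tensor2)
      \<Rightarrow> ('k \<Rightarrow> 'a::{ring, monoid_mult} \<Rightarrow> 'a) \<Rightarrow> ('h \<Rightarrow> 'a \<Rightarrow> 'a) \<Rightarrow> ('h \<Rightarrow> 'h \<Rightarrow> 'a)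
      \<Rightarrow> ('a, 'h) tensor2 set" where
  "cp_space s \<Delta> sA act \<omega> =
    (\<lambda>X. cp_mult s \<Delta> sA act \<omega> X (tens2 sA s [(1, 1)])) ` tensor_space sA s"

text \<open>The element \<open>a # h\<close>; it does not depend on the cocycle.\<close>

definition cp_elem ::
    "('k::comm_ring_1 \<Rightarrow> 'h::{ring, monoid_mult} \<Rightarrow> 'h) \<Rightarrow> ('h \<Rightarrow> ('h, 'h) tensor2)
      \<Rightarrow> ('k \<Rightarrow> 'a::{ring, monoid_mult} \<Rightarrow> 'a) \<Rightarrow> ('h \<Rightarrow> 'a \<Rightarrow> 'a)
      \<Rightarrow> 'a \<Rightarrow> 'h \<Rightarrow> ('a, 'h) tensor2" where
  "cp_elem s \<Delta> sA act a h = tens2 sA s [(a * act h1 1, h2). (h1, h2) \<leftarrow> cop2 s \<Delta> h]"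

definition cp_algebra_iso ::
    "('k::comm_ring_1 \<Rightarrow> 'h::{ring, monoid_mult} \<Rightarrow> 'h) \<Rightarrow> ('h \<Rightarrow> ('h, 'h) tensor2)
      \<Rightarrow> ('k \<Rightarrow> 'a::{ring, monoid_mult} \<Rightarrow> 'a)
      \<Rightarrow> ('h \<Rightarrow> 'a \<Rightarrow> 'a) \<Rightarrow> ('h \<Rightarrow> 'h \<Rightarrow> 'a) \<Rightarrow> ('h \<Rightarrow> 'a \<Rightarrow> 'a) \<Rightarrow> ('h \<Rightarrow> 'h \<Rightarrow> 'a)
      \<Rightarrow> (('a, 'h) tensor2 \<Rightarrow> ('a, 'h) tensor2) \<Rightarrow> bool" where
  "cp_algebra_iso s \<Delta> sA act \<omega> bact \<sigma> \<Phi> \<longleftrightarrow>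
    bij_betw \<Phi> (cp_space s \<Delta> sA act \<omega>) (cp_space s \<Delta> sA bact \<sigma>) \<and>
    (\<forall>X \<in> cp_space s \<Delta> sA act \<omega>. \<forall>Y \<in> cp_space s \<Delta> sA act \<omega>.
      \<Phi> (tens_sum sA s [X, Y]) = tens_sum sA s [\<Phi> X, \<Phi> Y]) \<and>
    (\<forall>c. \<forall>X \<in> cp_space s \<Delta> sA act \<omega>. \<Phi> (tens_scale sA s c X) = tens_scale sA s c (\<Phi> X)) \<and>
    (\<forall>X \<in> cp_space s \<Delta> sA act \<omega>. \<forall>Y \<in> cp_space s \<Delta> sA act \<omega>.
      \<Phi> (cp_mult s \<Delta> sA act \<omega> X Y) = cp_mult s \<Delta> sA bact \<sigma> (\<Phi> X) (\<Phi> Y)) \<and>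
    \<Phi> (cp_elem s \<Delta> sA act 1 1) = cp_elem s \<Delta> sA bact 1 1"

definition cp_module_map ::
    "('k::comm_ring_1 \<Rightarrow> 'h::{ring, monoid_mult} \<Rightarrow> 'h) \<Rightarrow> ('h \<Rightarrow> ('h, 'h) tensor2)
      \<Rightarrow> ('k \<Rightarrow> 'a::{ring, monoid_mult} \<Rightarrow> 'a)
      \<Rightarrow> ('h \<Rightarrow> 'a \<Rightarrow> 'a) \<Rightarrow> ('h \<Rightarrow> 'h \<Rightarrow> 'a) \<Rightarrow> ('h \<Rightarrow> 'a \<Rightarrow> 'a) \<Rightarrow> ('h \<Rightarrow> 'h \<Rightarrow> 'a)
      \<Rightarrow> (('a, 'h) tensor2 \<Rightarrow> ('a, 'h) tensor2) \<Rightarrow> bool" where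
  "cp_module_map s \<Delta> sA act \<omega> bact \<sigma> \<Phi> \<longleftrightarrow>
    (\<forall>a. \<forall>X \<in> cp_space s \<Delta> sA act \<omega>.
      \<Phi> (cp_mult s \<Delta> sA act \<omega> (cp_elem s \<Delta> sA act a 1) X) =
      cp_mult s \<Delta> sA bact \<sigma> (cp_elem s \<Delta> sA bact a 1) (\<Phi> X))"

text \<open>
  The coaction \<open>I \<otimes> \<Delta>\<close> takes values in \<open>A \<otimes> H \<otimes> H\<close>. The crossed product \<open>C = A # H\<close> is a direct
  summand of the module \<open>A \<otimes> H\<close>, so \<open>C \<otimes> H\<close> is identified with its image in \<open>A \<otimes> H \<otimes> H\<close>, i.e. the
  set of all \<open>join_tens s sA [(X1, h1), \<dots>, (Xr, hr)] = X1 \<otimes> h1 + \<dots> + Xr \<otimes> hr\<close> with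
  \<open>X1, \<dots>, Xr \<in> C\<close>; \<open>map_tens_id s sA C \<Phi>\<close> is \<open>\<Phi> \<otimes> I\<close> on that image.
\<close>

definition coaction ::
    "('k::comm_ring_1 \<Rightarrow> 'h::ab_group_add \<Rightarrow> 'h) \<Rightarrow> ('h \<Rightarrow> ('h, 'h) tensor2)
      \<Rightarrow> ('k \<Rightarrow> 'a::ab_group_add \<Rightarrow> 'a) \<Rightarrow> ('a, 'h) tensor2 \<Rightarrow> ('a, 'h, 'h) tensor3" where
  "coaction s \<Delta> sA X =
    tens3 sA s s [(a, h1, h2). (a, h) \<leftarrow> pres2 sA s X, (h1, h2) \<leftarrow> cop2 s \<Delta> h]"

definition join_tens ::
    "('k::comm_ring_1 \<Rightarrow> 'h::ab_group_add \<Rightarrow> 'h) \<Rightarrow> ('k \<Rightarrow> 'a::ab_group_add \<Rightarrow> 'a)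
      \<Rightarrow> (('a, 'h) tensor2 \<times> 'h) list \<Rightarrow> ('a, 'h, 'h) tensor3" where
  "join_tens s sA Xs = tens3 sA s s [(a, l, h). (X, h) \<leftarrow> Xs, (a, l) \<leftarrow> pres2 sA s X]"

definition map_tens_id ::
    "('k::comm_ring_1 \<Rightarrow> 'h::ab_group_add \<Rightarrow> 'h) \<Rightarrow> ('k \<Rightarrow> 'a::ab_group_add \<Rightarrow> 'a)
      \<Rightarrow> ('a, 'h) tensor2 set \<Rightarrow> (('a, 'h) tensor2 \<Rightarrow> ('a, 'h) tensor2)
      \<Rightarrow> ('a, 'h, 'h) tensor3 \<Rightarrow> ('a, 'h, 'h) tensor3" where
  "map_tens_id s sA C \<Phi> T =
    join_tens s sA (map (apfst \<Phi>) (SOME Xs. fst ` set Xs \<subseteq> C \<and> join_tens s sA Xs = T))"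

definition cp_comodule_map ::
    "('k::comm_ring_1 \<Rightarrow> 'h::{ring, monoid_mult} \<Rightarrow> 'h) \<Rightarrow> ('h \<Rightarrow> ('h, 'h) tensor2)
      \<Rightarrow> ('k \<Rightarrow> 'a::{ring, monoid_mult} \<Rightarrow> 'a) \<Rightarrow> ('h \<Rightarrow> 'a \<Rightarrow> 'a) \<Rightarrow> ('h \<Rightarrow> 'h \<Rightarrow> 'a)
      \<Rightarrow> (('a, 'h) tensor2 \<Rightarrow> ('a, 'h) tensor2) \<Rightarrow> bool" where
  "cp_comodule_map s \<Delta> sA act \<omega> \<Phi> \<longleftrightarrow>
    (\<forall>X \<in> cp_space s \<Delta> sA act \<omega>.
      coaction s \<Delta> sA (\<Phi> X) = map_tens_id s sA (cp_space s \<Delta> sA act \<omega>) \<Phi> (coaction s \<Delta> sA X))"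

section \<open>Twisting by a pair of linear maps\<close>

definition twisting_pair ::
    "('k::comm_ring_1 \<Rightarrow> 'h::{ring, monoid_mult} \<Rightarrow> 'h) \<Rightarrow> ('h \<Rightarrow> ('h, 'h) tensor2)
      \<Rightarrow> ('k \<Rightarrow> 'a::{ring, monoid_mult} \<Rightarrow> 'a)
      \<Rightarrow> ('h \<Rightarrow> 'a \<Rightarrow> 'a) \<Rightarrow> ('h \<Rightarrow> 'h \<Rightarrow> 'a) \<Rightarrow> ('h \<Rightarrow> 'a \<Rightarrow> 'a) \<Rightarrow> ('h \<Rightarrow> 'h \<Rightarrow> 'a)
      \<Rightarrow> ('h \<Rightarrow> 'a) \<Rightarrow> ('h \<Rightarrow> 'a) \<Rightarrow> bool" where
  "twisting_pair s \<Delta> sA act \<omega> bact \<sigma> u v \<longleftrightarrow>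
    module_hom s sA u \<and> module_hom s sA v \<and>
    (\<forall>h. conv s \<Delta> u v h = act h 1) \<and>
    (\<forall>h. u h = (\<Sum>(h1, h2)\<leftarrow>cop2 s \<Delta> h. u h1 * act h2 1) \<and>
         u h = (\<Sum>(h1, h2)\<leftarrow>cop2 s \<Delta> h. act h1 1 * u h2)) \<and>
    (\<forall>h a. bact h a = (\<Sum>(h1, h2, h3)\<leftarrow>cop3 s \<Delta> h. v h1 * act h2 a * u h3)) \<and>
    (\<forall>h k. \<sigma> h k =
      (\<Sum>(h1, h2, h3, h4)\<leftarrow>cop4 s \<Delta> h. \<Sum>(k1, k2, k3)\<leftarrow>cop3 s \<Delta> k.
        v h1 * act h2 (v k1) * \<omega> h3 k2 * u (h4 * k3)))"

text \<open>
  \<open>\<Phi> (a # h) = \<Sum> a u(h\<^sub>1) # h\<^sub>2\<close>. As the elements \<open>a # h\<close> span the crossed product, this determines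
  an additive \<open>\<Phi>\<close> there.
\<close>

definition twisting_formula ::
    "('k::comm_ring_1 \<Rightarrow> 'h::{ring, monoid_mult} \<Rightarrow> 'h) \<Rightarrow> ('h \<Rightarrow> ('h, 'h) tensor2)
      \<Rightarrow> ('k \<Rightarrow> 'a::{ring, monoid_mult} \<Rightarrow> 'a) \<Rightarrow> ('h \<Rightarrow> 'a \<Rightarrow> 'a) \<Rightarrow> ('h \<Rightarrow> 'a \<Rightarrow> 'a)
      \<Rightarrow> ('h \<Rightarrow> 'a) \<Rightarrow> (('a, 'h) tensor2 \<Rightarrow> ('a, 'h) tensor2) \<Rightarrow> bool" where
  "twisting_formula s \<Delta> sA act bact u \<Phi> \<longleftrightarrow>
    (\<forall>a h. \<Phi> (cp_elem s \<Delta> sA act a h) =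
      tens_sum sA s [cp_elem s \<Delta> sA bact (a * u h1) h2. (h1, h2) \<leftarrow> cop2 s \<Delta> h])"

end

(*
Write e(h) for the value of h on the unit of A. The crossed product is the image of the idempotent
T_e, where T_f(a (x) h) = a f(h_1) (x) h_2 for f in Hom(H, A), and T_g T_f = T_(f*g). A left A-linear
and right H-colinear map between the two crossed products is T_u for u(h) = (I (x) eps) Phi(1 # h),
so an isomorphism and its inverse give u and v with u*v = e and v*u = e', the function e of the
second action. Products of elements T_f(a (x) h), T_g(b (x) l) have the form a F(h_1, l_1) (x) h_2 l_2
with F in Hom(H (x) H, A), and F is recovered by applying eps to the second factor. Multiplicativity
of T_u thus becomes an identity in the convolution algebra Hom(H (x) H, A), which is equivalent to
(iii) and (iv) because u and v are inverse to each other up to the idempotents e and e'.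

Conversely, v*u = e' follows from (iii). Since v = v*e is not assumed, T_v inverts T_u only on the
crossed products, which is all that is needed.
*)

theory Submission
  imports Defs "HOL-Library.Multiset"
begin

section \<open>Additive extensions and cosets\<close>

text \<open>Tensors are cosets, and Sweedler lists and values of \<open>\<Phi>\<close> are
  accessible only through chosen presentations. Computations therefore run on representatives in
  free abelian groups modulo a subgroup, and a balancedness check disposes of each choice. The
  identity behind multiplicativity keeps a free b in A. In Hom(H (x) H, A) it reads: (x . b e(y)) *
  \<omega> * u(xy) equals u * (x \<bullet> b u(y)) * \<sigma>. At y = 1 the cocycles reduce to e and
  e', leaving u * (h \<bullet> b) = (h . b) * u, which is (iii) after multiplication by v. At b = 1
  it gives (iv), once u has been moved across the action and cancelled against v, first outside the
  action and then inside it. Conversely, these two cases rebuild the identity for all b. The map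
  \<Phi> (x) I on C (x) H is defined through a choice. It is controlled by extending \<Phi> to
  \<Phi> T_e on all of A (x) H, so that \<Phi> (x) I becomes the restriction of a map on A (x) H (x)
  H.\<close>

lemma formal_sum_Nil [simp]: "formal_sum [] = 0"
  and formal_sum_Cons [simp]: "formal_sum (x # xs) = frag_of x + formal_sum xs"
  and formal_sum_append [simp]: "formal_sum (xs @ ys) = formal_sum xs + formal_sum ys"
  by (simp_all add: formal_sum_def)

lemma formal_sum_concat [simp]: "formal_sum (concat (map f xs)) = (\<Sum>x\<leftarrow>xs. formal_sum (f x))"
  by (induction xs) auto

lemma formal_sum_map [simp]: "formal_sum (map f xs) = (\<Sum>x\<leftarrow>xs. frag_of (f x))"
  by (simp add: formal_sum_def comp_def)

lemma sum_list_map_concat: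
  "(\<Sum>x\<leftarrow>concat xss. f x) = (\<Sum>xs\<leftarrow>xss. \<Sum>x\<leftarrow>xs. f x :: 'g::comm_monoid_add)"
  by (induction xss) auto

lemma lookup_formal_sum: "poly_mapping.lookup (formal_sum xs) x = int (count (mset xs) x)"
  by (induction xs) (auto simp: lookup_add lookup_single when_def)

text \<open>Coefficients count occurrences, so a formal sum remembers its list up to order. This is
  what makes \<open>fext\<close> well defined.\<close>

lemma formal_sum_eq_iff_mset: "formal_sum xs = formal_sum ys \<longleftrightarrow> mset xs = mset ys"
proof
  assume "formal_sum xs = formal_sum ys"
  then show "mset xs = mset ys"
    by (metis lookup_formal_sum multiset_eqI of_nat_eq_iff)
next
  assume "mset xs = mset ys"
  then show "formal_sum xs = formal_sum ys"
    by (intro poly_mapping_eqI) (simp add: lookup_formal_sum)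
qed

text \<open>Lists have nonnegative coefficients only, so the negative part needs a second list. This
  normal form mostly replaces induction over the free group below.\<close>

lemma formal_sum_diff_exists: "\<exists>xs ys. p = formal_sum xs - formal_sum ys"
proof -
  have "Poly_Mapping.keys p \<subseteq> UNIV"
    by simp
  then show ?thesis
  proof (induction p rule: frag_induction)
    case zero
    show ?case
      by (rule exI[of _ "[]"], rule exI[of _ "[]"]) simp
  next
    case (one x)
    show ?case
      by (rule exI[of _ "[x]"], rule exI[of _ "[]"]) simp
  next
    case (diff p q)
    then obtain xs ys xs' ys'
      where "p = formal_sum xs - formal_sum ys" "q = formal_sum xs' - formal_sum ys'"
      by blast
    then have "p - q = formal_sum (xs @ ys') - formal_sum (ys @ xs')"
      by simp
    then show ?case
      by blast
  qed
qed

text \<open>The homomorphism given by the universal property of the free abelian group. The choice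
  is among equal values: two presentations as a difference of lists agree up to order after
  cross-adding.\<close>

definition fext :: "('x \<Rightarrow> 'g::ab_group_add) \<Rightarrow> ('x \<Rightarrow>\<^sub>0 int) \<Rightarrow> 'g" where
  "fext f p = (SOME g. \<exists>xs ys. p = formal_sum xs - formal_sum ys \<and>
    g = (\<Sum>x\<leftarrow>xs. f x) - (\<Sum>y\<leftarrow>ys. f y))"

lemma fext_diff_formal_sum:
  "fext f (formal_sum xs - formal_sum ys) = (\<Sum>x\<leftarrow>xs. f x) - (\<Sum>y\<leftarrow>ys. f y)"
proof -
  have "(\<Sum>x\<leftarrow>xs'. f x) - (\<Sum>y\<leftarrow>ys'. f y) = (\<Sum>x\<leftarrow>xs. f x) - (\<Sum>y\<leftarrow>ys. f y)"
    if "formal_sum xs - formal_sum ys = formal_sum xs' - formal_sum ys'" for xs' ys'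
  proof -
    have "formal_sum (xs @ ys') = formal_sum (xs' @ ys)"
      using that by (simp add: algebra_simps)
    then have "mset (map f (xs @ ys')) = mset (map f (xs' @ ys))"
      by (simp only: formal_sum_eq_iff_mset mset_map)
    then have "sum_list (map f (xs @ ys')) = sum_list (map f (xs' @ ys))"
      by (metis sum_mset_sum_list)
    then show ?thesis
      by (simp add: algebra_simps)
  qed
  then show ?thesis
    unfolding fext_def by (intro some_equality) blast+
qed

lemma fext_formal_sum [simp]: "fext f (formal_sum xs) = (\<Sum>x\<leftarrow>xs. f x)"
  using fext_diff_formal_sum[of f xs "[]"] by simp

lemma fext_frag_of [simp]: "fext f (frag_of x) = f x"
  using fext_formal_sum[of f "[x]"] by simp

lemma additive_fext: "additive (fext f)"
proof
  fix p q :: "'a \<Rightarrow>\<^sub>0 int"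
  obtain xs ys xs' ys' where
    *: "p = formal_sum xs - formal_sum ys" "q = formal_sum xs' - formal_sum ys'"
    using formal_sum_diff_exists by metis
  then have "p + q = formal_sum (xs @ xs') - formal_sum (ys @ ys')"
    by simp
  then show "fext f (p + q) = fext f p + fext f q"
    unfolding * by (simp only: fext_diff_formal_sum) (simp add: algebra_simps)
qed

lemmas fext_add [simp] = additive.add[OF additive_fext]
  and fext_diff [simp] = additive.diff[OF additive_fext]
  and fext_zero [simp] = additive.zero[OF additive_fext]

lemma additive_sum_list:
  assumes "additive f"
  shows "f (\<Sum>x\<leftarrow>xs. g x) = (\<Sum>x\<leftarrow>xs. f (g x))"
  by (induction xs) (auto simp: additive.zero[OF assms] additive.add[OF assms])

lemmas fext_sum_list [simp] = additive_sum_list[OF additive_fext]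

lemma fext_fext: "fext f (fext g p) = fext (\<lambda>x. fext f (g x)) p"
  using formal_sum_diff_exists[of p] by auto

lemma fext_addf: "fext (\<lambda>x. f x + g x) p = fext f p + fext g p"
  using formal_sum_diff_exists[of p] by (auto simp: sum_list_addf)

lemma sum_list_swap:
  "(\<Sum>x\<leftarrow>xs. \<Sum>y\<leftarrow>ys. f x y) = (\<Sum>y\<leftarrow>ys. \<Sum>x\<leftarrow>xs. f x y :: 'g::comm_monoid_add)"
  by (induction xs) (auto simp: sum_list_addf)

section \<open>Congruence modulo a subgroup\<close>

definition subgrp :: "'g::ab_group_add set \<Rightarrow> bool" where
  "subgrp K \<longleftrightarrow> 0 \<in> K \<and> (\<forall>p\<in>K. \<forall>q\<in>K. p - q \<in> K)"

text \<open>Equality of cosets serves as congruence modulo \<open>K\<close>. For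
  \<open>K = {0}\<close> it is plain equality, so one lemma covers maps into A and maps into a
  tensor product.\<close>

definition cls :: "'g::ab_group_add set \<Rightarrow> 'g \<Rightarrow> 'g set" where
  "cls K p = {q. q - p \<in> K}"

lemma subgrp_trivial [simp]: "subgrp {0}"
  by (simp add: subgrp_def)

lemma subgrp_null2 [simp]: "subgrp (null2 sM sN)"
  by (simp add: subgrp_def null2.zero null2.diff)

lemma subgrp_null3 [simp]: "subgrp (null3 sL sM sN)"
  by (simp add: subgrp_def null3.zero null3.diff)

lemma subgrp_minus: "subgrp K \<Longrightarrow> p \<in> K \<Longrightarrow> - p \<in> K"
  unfolding subgrp_def by (metis diff_0)

lemma subgrp_plus: "subgrp K \<Longrightarrow> p \<in> K \<Longrightarrow> q \<in> K \<Longrightarrow> p + q \<in> K"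
  using subgrp_minus[of K q] unfolding subgrp_def by (metis diff_minus_eq_add)

lemma cls_eq_iff:
  assumes "subgrp K"
  shows "cls K p = cls K q \<longleftrightarrow> p - q \<in> K"
proof
  assume "cls K p = cls K q"
  moreover have "p \<in> cls K p"
    using assms by (simp add: cls_def subgrp_def)
  ultimately show "p - q \<in> K"
    by (simp add: cls_def)
next
  assume *: "p - q \<in> K"
  have "r - p \<in> K \<longleftrightarrow> r - q \<in> K" for r
    using subgrp_plus[OF assms _ *, of "r - p"] * assms
    unfolding subgrp_def by (metis diff_add_cancel diff_diff_eq2 add_diff_eq)
  then show "cls K p = cls K q"
    by (simp add: cls_def)
qed

lemma cls_trivial [simp]: "cls {0} p = cls {0} q \<longleftrightarrow> p = q"
  by (simp add: cls_eq_iff)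

lemma cls_add:
  assumes "subgrp K" "cls K p = cls K p'" "cls K q = cls K q'"
  shows "cls K (p + q) = cls K (p' + q')"
  using subgrp_plus[OF assms(1), of "p - p'" "q - q'"] assms
  by (simp add: cls_eq_iff algebra_simps)

lemma cls_diff:
  assumes "subgrp K" "cls K p = cls K p'" "cls K q = cls K q'"
  shows "cls K (p - q) = cls K (p' - q')"
proof -
  have "(p - p') - (q - q') \<in> K"
    using assms by (simp add: cls_eq_iff subgrp_def)
  then show ?thesis
    using assms(1) by (simp add: cls_eq_iff algebra_simps)
qed

lemma cls_sum_list:
  assumes "subgrp K" "\<And>x. x \<in> set xs \<Longrightarrow> cls K (f x) = cls K (g x)"
  shows "cls K (\<Sum>x\<leftarrow>xs. f x) = cls K (\<Sum>x\<leftarrow>xs. g x)"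
  using assms(2)
proof (induction xs)
  case (Cons x xs)
  then show ?case
    using cls_add[OF assms(1), of "f x" "g x" "\<Sum>x\<leftarrow>xs. f x" "\<Sum>x\<leftarrow>xs. g x"] by simp
qed simp

lemma fext_cong_mod:
  assumes "subgrp K" "\<And>x. cls K (f x) = cls K (g x)"
  shows "cls K (fext f p) = cls K (fext g p)"
proof -
  obtain xs ys where "p = formal_sum xs - formal_sum ys"
    using formal_sum_diff_exists by metis
  then show ?thesis
    by (simp only: fext_diff_formal_sum) (intro cls_diff cls_sum_list assms)
qed

text \<open>Embeddings such as a \<mapsto> \<open>frag_of (a, h)\<close>, and choices of
  representatives of a linear map on tensors, are additive only in this weak sense.\<close>

definition add_mod :: "'g::ab_group_add set \<Rightarrow> ('m::ab_group_add \<Rightarrow> 'g) \<Rightarrow> bool" where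
  "add_mod K f \<longleftrightarrow> (\<forall>x y. cls K (f (x + y)) = cls K (f x + f y))"

lemma add_mod_sum_list:
  assumes "subgrp K" "add_mod K f"
  shows "cls K (f (\<Sum>x\<leftarrow>xs. g x)) = cls K (\<Sum>x\<leftarrow>xs. f (g x))"
proof (induction xs)
  case Nil
  \<comment> \<open>Since 0 + 0 = 0, this forces \<open>f 0\<close> into \<open>K\<close>.\<close>
  have "cls K (f (0 + 0)) = cls K (f 0 + f 0)"
    using assms(2) unfolding add_mod_def by blast
  then show ?case
    using subgrp_minus[OF assms(1), of "- f 0"] by (simp add: cls_eq_iff assms(1))
next
  case (Cons x xs)
  have "cls K (f (g x + (\<Sum>x\<leftarrow>xs. g x))) = cls K (f (g x) + f (\<Sum>x\<leftarrow>xs. g x))"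
    using assms(2) unfolding add_mod_def by blast
  also have "\<dots> = cls K (f (g x) + (\<Sum>x\<leftarrow>xs. f (g x)))"
    by (intro cls_add assms(1) Cons refl)
  finally show ?case
    by simp
qed

lemma add_mod_fext:
  assumes "subgrp K" "add_mod K f"
  shows "cls K (f p) = cls K (fext (\<lambda>x. f (frag_of x)) p)"
proof -
  obtain xs ys where p: "p = formal_sum xs - formal_sum ys"
    using formal_sum_diff_exists by metis
  have sum: "cls K (f (formal_sum zs)) = cls K (\<Sum>z\<leftarrow>zs. f (frag_of z))" for zs
    unfolding formal_sum_def by (rule add_mod_sum_list[OF assms])
  have "cls K (f (p + formal_sum ys)) = cls K (f p + f (formal_sum ys))"
    using assms(2) by (simp add: add_mod_def)
  then have "cls K (f p) = cls K (f (formal_sum xs) - f (formal_sum ys))"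
    by (simp add: p cls_eq_iff[OF assms(1)])
      (metis (no_types, lifting) assms(1) add_diff_cancel_left' diff_diff_eq2 minus_diff_eq
        subgrp_minus add.commute)
  also have "\<dots> = cls K (fext (\<lambda>x. f (frag_of x)) p)"
    unfolding p fext_diff_formal_sum by (intro cls_diff assms(1) sum)
  finally show ?thesis .
qed

section \<open>Balanced maps and the universal property of tensor products\<close>

definition bal2 ::
    "('k::comm_ring_1 \<Rightarrow> 'm::ab_group_add \<Rightarrow> 'm) \<Rightarrow> ('k \<Rightarrow> 'n::ab_group_add \<Rightarrow> 'n)
      \<Rightarrow> 'g::ab_group_add set \<Rightarrow> ('m \<Rightarrow> 'n \<Rightarrow> 'g) \<Rightarrow> bool" where
  "bal2 sM sN K f \<longleftrightarrow>
    (\<forall>m m' n. cls K (f (m + m') n) = cls K (f m n + f m' n)) \<and>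
    (\<forall>m n n'. cls K (f m (n + n')) = cls K (f m n + f m n')) \<and>
    (\<forall>c m n. cls K (f (sM c m) n) = cls K (f m (sN c n)))"

definition bal3 ::
    "('k::comm_ring_1 \<Rightarrow> 'l::ab_group_add \<Rightarrow> 'l) \<Rightarrow> ('k \<Rightarrow> 'm::ab_group_add \<Rightarrow> 'm)
      \<Rightarrow> ('k \<Rightarrow> 'n::ab_group_add \<Rightarrow> 'n) \<Rightarrow> 'g::ab_group_add set
      \<Rightarrow> ('l \<Rightarrow> 'm \<Rightarrow> 'n \<Rightarrow> 'g) \<Rightarrow> bool" where
  "bal3 sL sM sN K f \<longleftrightarrow>
    (\<forall>l l' m n. cls K (f (l + l') m n) = cls K (f l m n + f l' m n)) \<and>
    (\<forall>l m m' n. cls K (f l (m + m') n) = cls K (f l m n + f l m' n)) \<and>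
    (\<forall>l m n n'. cls K (f l m (n + n')) = cls K (f l m n + f l m n')) \<and>
    (\<forall>c l m n. cls K (f (sL c l) m n) = cls K (f l (sM c m) n)) \<and>
    (\<forall>c l m n. cls K (f l (sM c m) n) = cls K (f l m (sN c n)))"

abbreviation ext2 :: "('m \<Rightarrow> 'n \<Rightarrow> 'g::ab_group_add) \<Rightarrow> (('m \<times> 'n) \<Rightarrow>\<^sub>0 int) \<Rightarrow> 'g" where
  "ext2 f \<equiv> fext (\<lambda>(m, n). f m n)"

abbreviation ext3 ::
    "('l \<Rightarrow> 'm \<Rightarrow> 'n \<Rightarrow> 'g::ab_group_add) \<Rightarrow> (('l \<times> 'm \<times> 'n) \<Rightarrow>\<^sub>0 int) \<Rightarrow> 'g" where
  "ext3 f \<equiv> fext (\<lambda>(l, m, n). f l m n)"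

text \<open>The clauses of \<open>bal2\<close> say exactly that the generating relations are sent
  into \<open>K\<close>; closure of \<open>K\<close> under differences does the rest.\<close>

lemma ext2_null2:
  assumes "subgrp K" "bal2 sM sN K f" "p \<in> null2 sM sN"
  shows "ext2 f p \<in> K"
  using assms(3)
proof induction
  case zero
  then show ?case
    using assms(1) by (simp add: subgrp_def)
next
  case (diff p q)
  then show ?case
    using assms(1) by (simp add: subgrp_def)
qed (use assms(1,2) in \<open>simp_all add: bal2_def cls_eq_iff diff_diff_eq\<close>)

lemma ext3_null3:
  assumes "subgrp K" "bal3 sL sM sN K f" "p \<in> null3 sL sM sN"
  shows "ext3 f p \<in> K"
  using assms(3)
proof induction
  case zero
  then show ?case
    using assms(1) by (simp add: subgrp_def)
next
  case (diff p q)
  then show ?case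
    using assms(1) by (simp add: subgrp_def)
qed (use assms(1,2) in \<open>simp_all add: bal3_def cls_eq_iff diff_diff_eq\<close>)

lemma ext2_cls:
  assumes "subgrp K" "bal2 sM sN K f" "cls (null2 sM sN) p = cls (null2 sM sN) q"
  shows "cls K (ext2 f p) = cls K (ext2 f q)"
  using ext2_null2[OF assms(1,2), of "p - q"] assms(3) by (simp add: cls_eq_iff assms(1))

lemma ext3_cls:
  assumes "subgrp K" "bal3 sL sM sN K f" "cls (null3 sL sM sN) p = cls (null3 sL sM sN) q"
  shows "cls K (ext3 f p) = cls K (ext3 f q)"
  using ext3_null3[OF assms(1,2), of "p - q"] assms(3) by (simp add: cls_eq_iff assms(1))

lemma bal2_fext:
  assumes "subgrp K" "\<And>x. bal2 sM sN K (\<lambda>m n. f m n x)"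
  shows "bal2 sM sN K (\<lambda>m n. fext (f m n) p)"
  using assms(2) unfolding bal2_def fext_addf[symmetric]
  by (intro conjI allI fext_cong_mod assms(1)) blast+

lemma tens2_cls: "tens2 sM sN xs = cls (null2 sM sN) (formal_sum xs)"
  by (simp add: tens2_def cls_def)

lemma tens3_cls: "tens3 sL sM sN xs = cls (null3 sL sM sN) (formal_sum xs)"
  by (simp add: tens3_def cls_def)

lemma null2_rules:
  "cls (null2 sM sN) (frag_of (m + m', n)) = cls (null2 sM sN) (frag_of (m, n) + frag_of (m', n))"
  "cls (null2 sM sN) (frag_of (m, n + n')) = cls (null2 sM sN) (frag_of (m, n) + frag_of (m, n'))"
  "cls (null2 sM sN) (frag_of (sM c m, n)) = cls (null2 sM sN) (frag_of (m, sN c n))"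
  by (simp_all add: cls_eq_iff null2.intros flip: diff_diff_eq)

lemma null3_rules:
  "cls (null3 sL sM sN) (frag_of (l + l', m, n)) =
    cls (null3 sL sM sN) (frag_of (l, m, n) + frag_of (l', m, n))"
  "cls (null3 sL sM sN) (frag_of (l, m + m', n)) =
    cls (null3 sL sM sN) (frag_of (l, m, n) + frag_of (l, m', n))"
  "cls (null3 sL sM sN) (frag_of (l, m, n + n')) =
    cls (null3 sL sM sN) (frag_of (l, m, n) + frag_of (l, m, n'))"
  "cls (null3 sL sM sN) (frag_of (sL c l, m, n)) = cls (null3 sL sM sN) (frag_of (l, sM c m, n))"
  "cls (null3 sL sM sN) (frag_of (l, sM c m, n)) = cls (null3 sL sM sN) (frag_of (l, m, sN c n))"
  by (simp_all add: cls_eq_iff null3.intros flip: diff_diff_eq)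

text \<open>Lists carry no signs, but the first factor can absorb them: -(m (x) n) = (-m) (x) n.
  Hence every coset comes from a list and \<open>pres2\<close> can be undone.\<close>

lemma cls_in_tensor_space [simp]: "cls (null2 sM sN) p \<in> tensor_space sM sN"
proof -
  obtain xs ys where p: "p = formal_sum xs - formal_sum ys"
    using formal_sum_diff_exists by metis
  have neg: "cls (null2 sM sN) (- frag_of (m, n)) = cls (null2 sM sN) (frag_of (- m, n))" for m n
  proof -
    have "add_mod (null2 sM sN) (\<lambda>m. frag_of (m, n))"
      by (simp add: add_mod_def null2_rules)
    from add_mod_sum_list[OF _ this, of "\<lambda>x. x" "[m, - m]"]
      add_mod_sum_list[OF _ this, of "\<lambda>x. x" "[]"]
    have "cls (null2 sM sN) 0 = cls (null2 sM sN) (frag_of (m, n) + frag_of (- m, n))"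
      by simp
    then show ?thesis
      using subgrp_minus[of "null2 sM sN"] by (simp add: cls_eq_iff)
  qed
  have "cls (null2 sM sN) p = cls (null2 sM sN) (formal_sum xs + (\<Sum>y\<leftarrow>ys. - frag_of y))"
    by (simp only: p formal_sum_def diff_conv_add_uminus uminus_sum_list_map comp_def)
  also have "\<dots> = cls (null2 sM sN) (formal_sum xs + (\<Sum>(m, n)\<leftarrow>ys. frag_of (- m, n)))"
    by (intro cls_add cls_sum_list refl) (auto simp: neg)
  also have "\<dots> = tens2 sM sN (xs @ map (\<lambda>(m, n). (- m, n)) ys)"
    by (simp add: tens2_cls formal_sum_def comp_def case_prod_unfold)
  finally show ?thesis
    by (simp add: tensor_space_def)
qed

lemma tensor_space_cls:
  assumes "X \<in> tensor_space sM sN"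
  shows "cls (null2 sM sN) (formal_sum (pres2 sM sN X)) = X"
proof -
  obtain xs where "tens2 sM sN xs = X"
    using assms by (auto simp: tensor_space_def)
  then have "tens2 sM sN (pres2 sM sN X) = X"
    unfolding pres2_def by (rule someI)
  then show ?thesis
    by (simp add: tens2_cls)
qed

lemma pres2_cls: "cls (null2 sM sN) (formal_sum (pres2 sM sN (cls (null2 sM sN) p))) =
    cls (null2 sM sN) p"
  by (simp add: tensor_space_cls)

text \<open>This removes the choice in \<open>pres2\<close>: for a balanced summand any
  representative may replace the chosen list.\<close>

lemma sum_pres2:
  assumes "subgrp K" "bal2 sM sN K f"
  shows "cls K (\<Sum>(m, n)\<leftarrow>pres2 sM sN (cls (null2 sM sN) p). f m n) = cls K (ext2 f p)"
  using ext2_cls[OF assms pres2_cls] by simp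

lemma tens_sum_cls:
  "tens_sum sM sN (map (\<lambda>x. cls (null2 sM sN) (f x)) xs) = cls (null2 sM sN) (\<Sum>x\<leftarrow>xs. f x)"
proof -
  have "cls (null2 sM sN) (\<Sum>x\<leftarrow>xs. formal_sum (pres2 sM sN (cls (null2 sM sN) (f x)))) =
      cls (null2 sM sN) (\<Sum>x\<leftarrow>xs. f x)"
    by (intro cls_sum_list pres2_cls) simp
  then show ?thesis
    by (simp add: tens_sum_def tens2_cls comp_def)
qed

lemma tens_sum_pair:
  "tens_sum sM sN [cls (null2 sM sN) p, cls (null2 sM sN) q] = cls (null2 sM sN) (p + q)"
  using tens_sum_cls[of sM sN id "[p, q]"] by simp

section \<open>Sweedler sums and convolution\<close>

locale hopf_pair = H: hopf_algebra s \<Delta> \<epsilon> S + A: unital_algebra sA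
  for s :: "'k::comm_ring_1 \<Rightarrow> 'h::{ring, monoid_mult} \<Rightarrow> 'h"
    and \<Delta> :: "'h \<Rightarrow> ('h, 'h) tensor2" and \<epsilon> :: "'h \<Rightarrow> 'k" and S :: "'h \<Rightarrow> 'h"
    and sA :: "'k \<Rightarrow> 'a::{ring, monoid_mult} \<Rightarrow> 'a"
begin

text \<open>Nesting this operator writes iterated coproducts with their bracketing visible, so that
  each use of coassociativity is an explicit rewriting.\<close>

definition sw :: "('h \<Rightarrow> 'h \<Rightarrow> 'g::comm_monoid_add) \<Rightarrow> 'h \<Rightarrow> 'g" where
  "sw f h = (\<Sum>(h1, h2)\<leftarrow>cop2 s \<Delta> h. f h1 h2)"

lemma sw_ext2: "sw f h = ext2 f (formal_sum (cop2 s \<Delta> h))"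
  by (simp add: sw_def)

lemma cls_cop2: "cls (null2 s s) (formal_sum (cop2 s \<Delta> h)) = \<Delta> h"
  by (simp add: cop2_def tensor_space_cls H.comult_closed)

text \<open>A balanced summand sees only the tensor \<open>\<Delta> h\<close>. The rules for sums,
  scalar multiples, products and the unit of H follow by choosing a suitable representative of the
  coproduct.\<close>

lemma sw_cls:
  assumes "subgrp K" "bal2 s s K f" "\<Delta> h = cls (null2 s s) p"
  shows "cls K (sw f h) = cls K (ext2 f p)"
  unfolding sw_ext2 by (intro ext2_cls[OF assms(1,2)]) (simp add: cls_cop2 assms(3))

lemma comult_add_cls:
  "\<Delta> (h + l) = cls (null2 s s) (formal_sum (cop2 s \<Delta> h) + formal_sum (cop2 s \<Delta> l))"
  using tens_sum_pair[of s s "formal_sum (cop2 s \<Delta> h)" "formal_sum (cop2 s \<Delta> l)"]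
  by (simp add: cls_cop2 H.comult_add)

lemma sw_mod_plus:
  assumes "subgrp K" "bal2 s s K f"
  shows "cls K (sw f (h + l)) = cls K (sw f h + sw f l)"
  using sw_cls[OF assms comult_add_cls] by (simp add: sw_ext2)

lemma sw_mod_scale:
  assumes "subgrp K" "bal2 s s K f"
  shows "cls K (sw f (s c h)) = cls K (sw (\<lambda>x y. f (s c x) y) h)"
proof -
  have "\<Delta> (s c h) = cls (null2 s s) (formal_sum [(s c m, n). (m, n) \<leftarrow> cop2 s \<Delta> h])"
    by (simp only: H.comult_scale tens_scale_def tens2_cls cop2_def)
  from sw_cls[OF assms this] show ?thesis
    by (simp add: sw_def comp_def case_prod_unfold)
qed

lemma sw_mod_mult:
  assumes "subgrp K" "bal2 s s K f"
  shows "cls K (sw f (h * l)) = cls K (sw (\<lambda>x y. sw (\<lambda>z w. f (x * z) (y * w)) l) h)"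
proof -
  have "\<Delta> (h * l) = cls (null2 s s) (formal_sum
      [(h1 * l1, h2 * l2). (h1, h2) \<leftarrow> cop2 s \<Delta> h, (l1, l2) \<leftarrow> cop2 s \<Delta> l])"
    by (simp only: H.comult_mult tens2_cls)
  from sw_cls[OF assms this] show ?thesis
    by (simp add: sw_def comp_def case_prod_unfold)
qed

lemma sw_mod_one:
  assumes "subgrp K" "bal2 s s K f"
  shows "cls K (sw f 1) = cls K (f 1 1)"
  using sw_cls[OF assms, of 1 "formal_sum [(1, 1)]"] by (simp add: H.comult_one tens2_cls)

lemma sw_mod_coassoc:
  assumes "subgrp K" "bal3 s s s K f"
  shows "cls K (sw (\<lambda>x h3. sw (\<lambda>h1 h2. f h1 h2 h3) x) h) =
    cls K (sw (\<lambda>h1 x. sw (\<lambda>h2 h3. f h1 h2 h3) x) h)"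
  using ext3_cls[OF assms H.coassoc[of h, unfolded tens3_cls]]
  by (simp add: sw_def comp_def case_prod_unfold)

lemmas sw_plus = sw_mod_plus[OF subgrp_trivial, simplified]
  and sw_scale = sw_mod_scale[OF subgrp_trivial, simplified]
  and sw_one = sw_mod_one[OF subgrp_trivial, simplified]
  and sw_coassoc = sw_mod_coassoc[OF subgrp_trivial, simplified]

lemma sw_cong_mod:
  assumes "subgrp K" "\<And>x y. cls K (f x y) = cls K (g x y)"
  shows "cls K (sw f h) = cls K (sw g h)"
  unfolding sw_def by (intro cls_sum_list assms(1)) (auto simp: assms(2))

lemma sw_addf: "sw (\<lambda>x y. f x y + g x y) h = sw f h + sw g h"
  by (simp add: sw_def case_prod_unfold sum_list_addf)

lemma sw_add_mod:
  assumes "subgrp K" "\<And>x y. cls K (f x y) = cls K (g x y + g' x y)"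
  shows "cls K (sw f h) = cls K (sw g h + sw g' h)"
  unfolding sw_addf[symmetric] by (intro sw_cong_mod assms)

lemma sw_swap: "sw (\<lambda>x y. sw (\<lambda>z w. f x y z w) l) h = sw (\<lambda>z w. sw (\<lambda>x y. f x y z w) h) l"
  unfolding sw_def case_prod_unfold by (rule sum_list_swap)

lemma sw_additive: "additive f \<Longrightarrow> f (sw g h) = sw (\<lambda>x y. f (g x y)) h"
  unfolding sw_def by (simp add: additive_sum_list case_prod_unfold)

lemma sw_add_mod_apply:
  assumes "subgrp K" "add_mod K f"
  shows "cls K (f (sw g h)) = cls K (sw (\<lambda>x y. f (g x y)) h)"
  unfolding sw_def by (simp add: add_mod_sum_list[OF assms] case_prod_unfold)

lemma fext_sw [simp]: "fext f (sw g h) = sw (\<lambda>x y. fext f (g x y)) h"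
  by (rule sw_additive[OF additive_fext])

lemma mult_sw: "a * sw g h = sw (\<lambda>x y. a * g x y) h" for a :: "'c::ring"
  by (rule sw_additive) (simp add: additive_def distrib_left)

lemma sw_times: "sw g h * a = sw (\<lambda>x y. g x y * a) h" for a :: "'c::ring"
  by (rule sw_additive[where f = "\<lambda>x. x * a"]) (simp add: additive_def distrib_right)

text \<open>Reason: m (x) h \<mapsto> m (x) h_1 (x) h_2 is well defined. A scalar taken off m is
  absorbed by the first leg of the coproduct.\<close>

lemma bal2_sw:
  assumes "subgrp K" "bal3 sM s s K f"
  shows "bal2 sM s K (\<lambda>m h. sw (f m) h)"
proof -
  have f: "bal2 s s K (f m)" for m
    using assms(2) by (simp add: bal2_def bal3_def)
  show ?thesis
    unfolding bal2_def
  proof (intro conjI allI)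
    fix m m' h h' c
    show "cls K (sw (f (m + m')) h) = cls K (sw (f m) h + sw (f m') h)"
      using assms(2) by (intro sw_add_mod assms(1)) (simp add: bal3_def)
    show "cls K (sw (f m) (h + h')) = cls K (sw (f m) h + sw (f m) h')"
      by (rule sw_mod_plus[OF assms(1) f])
    show "cls K (sw (f (sM c m)) h) = cls K (sw (f m) (s c h))"
      unfolding sw_mod_scale[OF assms(1) f]
      using assms(2) by (intro sw_cong_mod assms(1)) (simp add: bal3_def)
  qed
qed

section \<open>Linear and bilinear maps and their convolution products\<close>

definition lin :: "('h \<Rightarrow> 'a) \<Rightarrow> bool" where
  "lin f \<longleftrightarrow> (\<forall>x y. f (x + y) = f x + f y) \<and> (\<forall>c x. f (s c x) = sA c (f x))"

definition bil :: "('h \<Rightarrow> 'h \<Rightarrow> 'a) \<Rightarrow> bool" where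
  "bil F \<longleftrightarrow> (\<forall>x. lin (F x)) \<and> (\<forall>y. lin (\<lambda>x. F x y))"

lemma lin_iff_module_hom: "module_hom s sA f \<longleftrightarrow> lin f"
  using H.module_axioms A.module_axioms
  by (auto simp: lin_def module_hom_def module_hom_axioms_def)

lemma bil_iff_bilinear_map: "bilinear_map s s sA F \<longleftrightarrow> bil F"
  by (simp add: bilinear_map_def bil_def lin_iff_module_hom)

lemma linD:
  assumes "lin f"
  shows "f (x + y) = f x + f y" "f (s c x) = sA c (f x)"
  using assms by (auto simp: lin_def)

lemma bilD:
  assumes "bil F"
  shows "F (x + x') y = F x y + F x' y" "F x (y + y') = F x y + F x y'"
    "F (s c x) y = sA c (F x y)" "F x (s c y) = sA c (F x y)"
  using assms by (auto simp: bil_def lin_def)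

lemma bil_sections: "bil F \<Longrightarrow> lin (F x)" "bil F \<Longrightarrow> lin (\<lambda>x. F x y)"
  by (auto simp: bil_def)

lemmas sA_simps = A.scale_mult_left A.scale_mult_right A.scale_right_distrib

lemma sA_sw: "sA c (sw g h) = sw (\<lambda>x y. sA c (g x y)) h"
  by (rule sw_additive) (simp add: additive_def A.scale_right_distrib)

lemma lin_sw:
  assumes "bal2 s s {0} f" "\<And>c x y. f (s c x) y = sA c (f x y)"
  shows "lin (sw f)"
proof -
  have "(\<lambda>x. f (s c x)) = (\<lambda>x y. sA c (f x y))" for c
    by (intro ext assms(2))
  then show ?thesis
    by (simp add: lin_def sw_plus[OF assms(1)] sw_scale[OF assms(1)] sA_sw)
qed

abbreviation cnv :: "('h \<Rightarrow> 'a) \<Rightarrow> ('h \<Rightarrow> 'a) \<Rightarrow> 'h \<Rightarrow> 'a" where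
  "cnv \<equiv> conv s \<Delta>"

abbreviation cnv2 :: "('h \<Rightarrow> 'h \<Rightarrow> 'a) \<Rightarrow> ('h \<Rightarrow> 'h \<Rightarrow> 'a) \<Rightarrow> 'h \<Rightarrow> 'h \<Rightarrow> 'a" where
  "cnv2 \<equiv> conv2 s \<Delta>"

text \<open>
  The products of \<open>f \<in> Hom(H, A)\<close> with \<open>F \<in> Hom(H \<otimes> H, A)\<close>, where \<open>f\<close> is regarded as the map
  \<open>h \<otimes> k \<mapsto> f(h) \<epsilon>(k)\<close>.
\<close>

definition lcnv :: "('h \<Rightarrow> 'a) \<Rightarrow> ('h \<Rightarrow> 'h \<Rightarrow> 'a) \<Rightarrow> 'h \<Rightarrow> 'h \<Rightarrow> 'a" where
  "lcnv f F h k = sw (\<lambda>h1 h2. f h1 * F h2 k) h"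

definition rcnv :: "('h \<Rightarrow> 'h \<Rightarrow> 'a) \<Rightarrow> ('h \<Rightarrow> 'a) \<Rightarrow> 'h \<Rightarrow> 'h \<Rightarrow> 'a" where
  "rcnv F f h k = sw (\<lambda>h1 h2. F h1 k * f h2) h"

lemma cnv_sw: "cnv f g h = sw (\<lambda>x y. f x * g y) h"
  by (simp add: conv_def sw_def)

lemma cnv2_sw: "cnv2 F G h k = sw (\<lambda>h1 h2. sw (\<lambda>k1 k2. F h1 k1 * G h2 k2) k) h"
  by (simp add: conv2_def sw_def)

lemma lin_cnv [intro]: "lin f \<Longrightarrow> lin g \<Longrightarrow> lin (cnv f g)"
  unfolding cnv_sw[abs_def]
  by (intro lin_sw) (auto simp: bal2_def linD sA_simps algebra_simps)

lemma bil_lcnv [intro]: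
  assumes "lin f" "bil F"
  shows "bil (lcnv f F)"
proof -
  have "lin (\<lambda>h. lcnv f F h k)" for k
    unfolding lcnv_def using assms
    by (intro lin_sw) (auto simp: bal2_def linD bilD sA_simps algebra_simps)
  moreover have "lin (lcnv f F h)" for h
    using assms by (simp add: lin_def lcnv_def bilD sA_simps distrib_left sw_addf sA_sw)
  ultimately show ?thesis
    by (simp add: bil_def)
qed

lemma bil_cnv2 [intro]:
  assumes "bil F" "bil G"
  shows "bil (cnv2 F G)"
proof -
  have "lin (\<lambda>h. cnv2 F G h k)" for k
    unfolding cnv2_sw using assms
    by (intro lin_sw) (auto simp: bal2_def bilD sA_simps algebra_simps sA_sw simp flip: sw_addf)
  moreover have "lin (cnv2 F G h)" for h
    unfolding cnv2_sw sw_swap[of _ _ h] using assms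
    by (intro lin_sw) (auto simp: bal2_def bilD sA_simps algebra_simps sA_sw simp flip: sw_addf)
  ultimately show ?thesis
    by (simp add: bil_def)
qed

lemma bil_comp_mult [intro]: "lin f \<Longrightarrow> bil (\<lambda>h k. f (h * k))"
  by (auto simp: bil_def lin_def algebra_simps H.scale_mult_left H.scale_mult_right)

lemma cnv_assoc:
  assumes "lin f" "lin g" "lin k"
  shows "cnv (cnv f g) k = cnv f (cnv g k)"
proof
  fix h
  have "bal3 s s s {0} (\<lambda>x y z. f x * g y * k z)"
    using assms by (simp add: bal3_def linD sA_simps algebra_simps)
  from sw_coassoc[OF this] show "cnv (cnv f g) k h = cnv f (cnv g k) h"
    by (simp add: cnv_sw mult_sw sw_times mult.assoc)
qed

lemma lcnv_assoc:
  assumes "lin f" "lin g" "bil F"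
  shows "lcnv (cnv f g) F = lcnv f (lcnv g F)"
proof (intro ext)
  fix h k
  have "bal3 s s s {0} (\<lambda>x y z. f x * g y * F z k)"
    using assms by (simp add: bal3_def linD bilD sA_simps algebra_simps)
  from sw_coassoc[OF this] show "lcnv (cnv f g) F h k = lcnv f (lcnv g F) h k"
    by (simp add: cnv_sw lcnv_def mult_sw sw_times mult.assoc)
qed

lemma lcnv_cnv2:
  assumes "lin f" "bil F" "bil G"
  shows "lcnv f (cnv2 F G) = cnv2 (lcnv f F) G"
proof (intro ext)
  fix h k
  have "bal3 s s s {0} (\<lambda>x y z. sw (\<lambda>k1 k2. f x * F y k1 * G z k2) k)"
    using assms by (simp add: bal3_def linD bilD sA_simps algebra_simps sw_addf)
  from sw_coassoc[OF this] show "lcnv f (cnv2 F G) h k = cnv2 (lcnv f F) G h k"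
    by (simp add: cnv2_sw lcnv_def mult_sw sw_times mult.assoc sw_swap[of _ _ k])
qed

text \<open>An element of Hom(H, A) standing between two elements of Hom(H (x) H, A) may be attached
  to either neighbour.\<close>

lemma rcnv_cnv2:
  assumes "lin f" "bil F" "bil G"
  shows "cnv2 (rcnv F f) G = cnv2 F (lcnv f G)"
proof (intro ext)
  fix h k
  have "bal3 s s s {0} (\<lambda>x y z. sw (\<lambda>k1 k2. F x k1 * f y * G z k2) k)"
    using assms by (simp add: bal3_def linD bilD sA_simps algebra_simps sw_addf)
  from sw_coassoc[OF this] show "cnv2 (rcnv F f) G h k = cnv2 F (lcnv f G) h k"
    by (simp add: cnv2_sw lcnv_def rcnv_def mult_sw sw_times mult.assoc sw_swap[of _ _ k])
qed

text \<open>Coassociativity of the coalgebra H (x) H. Its coproduct interleaves the sums over h and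
  k; once they are separated, coassociativity applies to each variable in turn.\<close>

lemma sw2_mod_coassoc:
  assumes K: "subgrp K"
    and "\<And>k1 k2 k3. bal3 s s s K (\<lambda>h1 h2 h3. f h1 k1 h2 k2 h3 k3)"
    and "\<And>h1 h2 h3. bal3 s s s K (\<lambda>k1 k2 k3. f h1 k1 h2 k2 h3 k3)"
  shows
    "cls K (sw (\<lambda>x h3. sw (\<lambda>y k3. sw (\<lambda>h1 h2. sw (\<lambda>k1 k2. f h1 k1 h2 k2 h3 k3) y) x) k) h) =
     cls K (sw (\<lambda>h1 x. sw (\<lambda>k1 y. sw (\<lambda>h2 h3. sw (\<lambda>k2 k3. f h1 k1 h2 k2 h3 k3) y) x) k) h)"
    (is "cls K ?L = cls K ?R")
proof -
  have "cls K ?L =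
      cls K (sw (\<lambda>x h3. sw (\<lambda>h1 h2. sw (\<lambda>y k3. sw (\<lambda>k1 k2. f h1 k1 h2 k2 h3 k3) y) k) x) h)"
    by (simp only: sw_swap[of _ _ k])
  also have "\<dots> =
      cls K (sw (\<lambda>x h3. sw (\<lambda>h1 h2. sw (\<lambda>k1 y. sw (\<lambda>k2 k3. f h1 k1 h2 k2 h3 k3) y) k) x) h)"
    by (intro sw_cong_mod sw_mod_coassoc K assms(3))
  also have "\<dots> =
      cls K (sw (\<lambda>h1 x. sw (\<lambda>h2 h3. sw (\<lambda>k1 y. sw (\<lambda>k2 k3. f h1 k1 h2 k2 h3 k3) y) k) x) h)"
    using assms(2)
    by (intro sw_mod_coassoc K) (auto simp: bal3_def intro!: sw_add_mod sw_cong_mod K)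
  also have "\<dots> = cls K ?R"
    by (simp only: sw_swap[of _ _ k])
  finally show ?thesis .
qed

lemma cnv2_assoc:
  assumes "bil F" "bil G" "bil E"
  shows "cnv2 (cnv2 F G) E = cnv2 F (cnv2 G E)"
proof (intro ext)
  fix h k
  have "bal3 s s s {0} (\<lambda>h1 h2 h3. F h1 k1 * G h2 k2 * E h3 k3)" for k1 k2 k3
    using assms by (simp add: bal3_def bilD sA_simps algebra_simps)
  moreover have "bal3 s s s {0} (\<lambda>k1 k2 k3. F h1 k1 * G h2 k2 * E h3 k3)" for h1 h2 h3
    using assms by (simp add: bal3_def bilD sA_simps algebra_simps)
  ultimately show "cnv2 (cnv2 F G) E h k = cnv2 F (cnv2 G E) h k"
    using sw2_mod_coassoc[of "{0}" "\<lambda>h1 k1 h2 k2 h3 k3. F h1 k1 * G h2 k2 * E h3 k3" k h]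
    by (simp add: cnv2_sw mult_sw sw_times mult.assoc)
qed

lemma lin_counit_right: "lin f \<Longrightarrow> sw (\<lambda>x y. sA (\<epsilon> y) (f x)) h = f h"
proof -
  assume f: "lin f"
  then have "f (sw (\<lambda>x y. s (\<epsilon> y) x) h) = sw (\<lambda>x y. f (s (\<epsilon> y) x)) h"
    by (intro sw_additive) (simp add: additive_def linD)
  then show ?thesis
    using H.counit_right[of h] f by (simp add: sw_def linD)
qed

lemma counit_add [simp]: "\<epsilon> (x + y) = \<epsilon> x + \<epsilon> y"
  and counit_scale [simp]: "\<epsilon> (s c x) = c * \<epsilon> x"
  using H.counit_linear by (auto simp: module_hom_def module_hom_axioms_def)

end

section \<open>Operators on the tensor product\<close>

context hopf_pair
begin

abbreviation N :: "(('a \<times> 'h) \<Rightarrow>\<^sub>0 int) set" where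
  "N \<equiv> null2 sA s"

lemmas cls_frag_add = null2_rules(1,2)[of sA s]
  and cls_frag_scale = null2_rules(3)[of sA s]

lemma cls_frag_sw: "cls N (frag_of (sw f h, x)) = cls N (sw (\<lambda>y z. frag_of (f y z, x)) h)"
  by (rule sw_add_mod_apply[where f = "\<lambda>a. frag_of (a, x)"])
    (simp_all add: add_mod_def cls_frag_add)

lemma cls_frag_scale': "cls N (frag_of (a, s c h)) = cls N (frag_of (sA c a, h))"
  by (simp add: cls_frag_scale)

definition tau :: "('h \<Rightarrow> 'a) \<Rightarrow> 'a \<Rightarrow> 'h \<Rightarrow> ('a \<times> 'h) \<Rightarrow>\<^sub>0 int" where
  "tau f a h = sw (\<lambda>x y. frag_of (a * f x, y)) h"

definition T :: "('h \<Rightarrow> 'a) \<Rightarrow> (('a \<times> 'h) \<Rightarrow>\<^sub>0 int) \<Rightarrow> ('a \<times> 'h) \<Rightarrow>\<^sub>0 int" where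
  "T f = ext2 (tau f)"

lemma bal2_tau: "lin f \<Longrightarrow> bal2 sA s N (tau f)"
  unfolding tau_def
  by (intro bal2_sw)
    (auto simp: bal3_def linD sA_simps algebra_simps cls_frag_add cls_frag_scale')

lemma T_cls: "lin f \<Longrightarrow> cls N p = cls N q \<Longrightarrow> cls N (T f p) = cls N (T f q)"
  unfolding T_def by (rule ext2_cls[OF _ bal2_tau]) simp_all

lemma T_frag [simp]: "T f (frag_of (a, h)) = tau f a h"
  and T_add [simp]: "T f (p + q) = T f p + T f q"
  and T_sw [simp]: "T f (sw g h) = sw (\<lambda>x y. T f (g x y)) h"
  by (simp_all add: T_def)

text \<open>Coassociativity brings both coefficients onto the first leg of a single coproduct. New
  coefficients are appended on the right of a, hence f stands before g.\<close>

lemma T_tau: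
  assumes "lin f" "lin g"
  shows "cls N (T g (tau f a h)) = cls N (tau (cnv f g) a h)"
proof -
  have "bal3 s s s N (\<lambda>x y z. frag_of (a * f x * g y, z))"
    using assms
    by (auto simp: bal3_def linD sA_simps algebra_simps cls_frag_add cls_frag_scale')
  then have "cls N (T g (tau f a h)) =
      cls N (sw (\<lambda>x z. sw (\<lambda>y w. frag_of (a * f y * g w, z)) x) h)"
    by (simp add: tau_def sw_mod_coassoc)
  also have "\<dots> = cls N (tau (cnv f g) a h)"
    unfolding tau_def cnv_sw mult_sw
    by (intro sw_cong_mod) (simp_all add: cls_frag_sw mult.assoc)
  finally show ?thesis .
qed

lemma T_T:
  assumes "lin f" "lin g"
  shows "cls N (T g (T f p)) = cls N (T (cnv f g) p)"
  unfolding T_def[of f] T_def[of "cnv f g"]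
  unfolding T_def[of g] fext_fext
  by (intro fext_cong_mod) (auto simp: T_tau[OF assms] simp flip: T_def)

definition pf :: "('h \<Rightarrow> 'h \<Rightarrow> 'a) \<Rightarrow> 'a \<Rightarrow> 'h \<Rightarrow> 'h \<Rightarrow> ('a \<times> 'h) \<Rightarrow>\<^sub>0 int" where
  "pf F a h l = sw (\<lambda>h1 h2. sw (\<lambda>l1 l2. frag_of (a * F h1 l1, h2 * l2)) l) h"

text \<open>Multiplicativity of the coproduct splits h_2 l_2 leg by leg; coassociativity of H (x) H
  then gathers F and g(xy) into one convolution product.\<close>

lemma T_pf:
  assumes "bil F" "lin g"
  shows "cls N (T g (pf F a h l)) = cls N (pf (cnv2 F (\<lambda>x y. g (x * y))) a h l)"
proof -
  have "cls N (tau g b (x * y)) =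
      cls N (sw (\<lambda>x1 x2. sw (\<lambda>y1 y2. frag_of (b * g (x1 * y1), x2 * y2)) y) x)" for b x y
    unfolding tau_def using assms
    by (intro sw_mod_mult)
      (auto simp: bal2_def linD sA_simps algebra_simps cls_frag_add cls_frag_scale')
  then have "cls N (T g (pf F a h l)) =
      cls N (sw (\<lambda>h1 x. sw (\<lambda>l1 y. sw (\<lambda>h2 h3. sw (\<lambda>l2 l3.
        frag_of (a * F h1 l1 * g (h2 * l2), h3 * l3)) y) x) l) h)"
    unfolding pf_def T_sw T_frag by (intro sw_cong_mod) simp_all
  also have "\<dots> =
      cls N (sw (\<lambda>x h3. sw (\<lambda>y l3. sw (\<lambda>h1 h2. sw (\<lambda>l1 l2.
        frag_of (a * F h1 l1 * g (h2 * l2), h3 * l3)) y) x) l) h)"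
    using assms
    by (intro sw2_mod_coassoc[symmetric])
      (auto simp: bal3_def linD bilD sA_simps algebra_simps cls_frag_add cls_frag_scale'
        H.scale_mult_left H.scale_mult_right)
  also have "\<dots> = cls N (pf (cnv2 F (\<lambda>x y. g (x * y))) a h l)"
    unfolding pf_def cnv2_sw mult_sw
  proof (intro sw_cong_mod)
    fix x h3 y l3
    show "cls N (sw (\<lambda>h1 h2. sw (\<lambda>l1 l2.
          frag_of (a * F h1 l1 * g (h2 * l2), h3 * l3)) y) x) =
        cls N (frag_of (sw (\<lambda>h1 h2. sw (\<lambda>l1 l2. a * (F h1 l1 * g (h2 * l2))) y) x, h3 * l3))"
      unfolding cls_frag_sw by (intro sw_cong_mod) (simp_all add: cls_frag_sw mult.assoc)
  qed simp_all
  finally show ?thesis .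
qed

text \<open>The map I (x) \<epsilon>. Its values lie in A itself, so it turns congruences of tensors
  into equations between coefficients.\<close>

definition ev :: "(('a \<times> 'h) \<Rightarrow>\<^sub>0 int) \<Rightarrow> 'a" where
  "ev = ext2 (\<lambda>a h. sA (\<epsilon> h) a)"

lemma bal2_ev: "bal2 sA s {0} (\<lambda>a h. sA (\<epsilon> h) a)"
  by (simp add: bal2_def A.scale_right_distrib A.scale_left_distrib mult.commute)

lemma ev_cls: "cls N p = cls N q \<Longrightarrow> ev p = ev q"
  unfolding ev_def using ext2_cls[OF subgrp_trivial bal2_ev, of p q] by simp

lemma ev_frag [simp]: "ev (frag_of (a, h)) = sA (\<epsilon> h) a"
  and ev_sw [simp]: "ev (sw g h) = sw (\<lambda>x y. ev (g x y)) h"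
  and ev_add [simp]: "ev (p + q) = ev p + ev q"
  by (simp_all add: ev_def)

lemma ev_tau [simp]: "lin f \<Longrightarrow> ev (tau f a h) = a * f h"
  unfolding tau_def ev_sw ev_frag
  by (simp add: lin_counit_right flip: A.scale_mult_right mult_sw)

lemma ev_pf [simp]:
  assumes "bil F"
  shows "ev (pf F a h l) = a * F h l"
proof -
  have "ev (pf F a h l) = sw (\<lambda>h1 h2. sw (\<lambda>l1 l2. a * sA (\<epsilon> h2) (sA (\<epsilon> l2) (F h1 l1))) l) h"
    by (simp add: pf_def H.counit_mult A.scale_mult_right)
  also have "\<dots> = a * F h l"
    by (simp add: lin_counit_right bil_sections[OF assms] del: A.scale_scale flip: mult_sw sA_sw)
  finally show ?thesis .
qed

definition scl :: "'k \<Rightarrow> (('a \<times> 'h) \<Rightarrow>\<^sub>0 int) \<Rightarrow> ('a \<times> 'h) \<Rightarrow>\<^sub>0 int" where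
  "scl c = ext2 (\<lambda>a h. frag_of (sA c a, h))"

lemma bal2_scl: "bal2 sA s N (\<lambda>a h. frag_of (sA c a, h))"
  by (simp add: bal2_def A.scale_right_distrib cls_frag_add cls_frag_scale' mult.commute)

lemma tens_scale_cls: "tens_scale sA s c (cls N p) = cls N (scl c p)"
  using sum_pres2[OF _ bal2_scl[of c], of p]
  by (simp add: tens_scale_def tens2_cls scl_def formal_sum_def comp_def case_prod_unfold)

lemma T_scl: "T f (scl c p) = scl c (T f p)"
  unfolding T_def scl_def fext_fext
  by (rule arg_cong[where f = "\<lambda>f. fext f p"])
    (auto simp: tau_def A.scale_mult_left)

lemma ev_scl: "ev (scl c p) = sA c (ev p)"
proof -
  obtain xs ys where p: "p = formal_sum xs - formal_sum ys"
    using formal_sum_diff_exists by metis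
  have "additive (sA c)"
    by (simp add: additive_def A.scale_right_distrib)
  then show ?thesis
    by (simp add: p ev_def scl_def fext_fext case_prod_unfold A.scale_right_diff_distrib
        additive_sum_list mult.commute)
qed

end

section \<open>Partial actions and the crossed product\<close>

sublocale twisted_partial_action \<subseteq> hopf_pair s \<Delta> \<epsilon> S sA
  by unfold_locales

context twisted_partial_action
begin

lemma act_simps:
  "act (x + y) a = act x a + act y a" "act (s c x) a = sA c (act x a)"
  "act x (a + b) = act x a + act x b" "act x (sA c a) = sA c (act x a)"
  using act_bilinear
  by (auto simp: bilinear_map_def module_hom_def module_hom_axioms_def)

lemma bil_cocycle [simp, intro]: "bil \<omega>"
  using cocycle_bilinear by (simp add: bil_iff_bilinear_map)

lemma lin_act [simp, intro]: "lin (\<lambda>x. act x a)"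
  by (simp add: lin_def act_simps)

lemma bil_act [simp, intro]: "lin f \<Longrightarrow> bil (\<lambda>x y. act x (f y))"
  by (simp add: bil_def lin_def act_simps)

lemma act_sw: "act x (sw g h) = sw (\<lambda>y z. act x (g y z)) h"
  by (rule sw_additive) (simp add: additive_def act_simps)

abbreviation e :: "'h \<Rightarrow> 'a" where
  "e \<equiv> \<lambda>x. act x 1"

text \<open>The rule for h . (ab) read in the convolution algebra. It makes \<open>e\<close>
  idempotent (a = b = 1) and lets the action absorb \<open>e\<close> on either side.\<close>

lemma cnv_act: "cnv (\<lambda>x. act x a) (\<lambda>x. act x b) = (\<lambda>x. act x (a * b))"
  by (simp add: fun_eq_iff cnv_sw sw_def act_mult)

lemma lcnv_e_act: "lcnv e (\<lambda>x y. act x (f y)) = (\<lambda>x y. act x (f y))"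
  using cnv_act[of 1] by (simp add: fun_eq_iff lcnv_def cnv_sw)

lemma cnv2_act:
  "cnv2 (\<lambda>x y. act x (f y)) (\<lambda>x y. act x (g y)) = (\<lambda>x y. act x (cnv f g y))"
proof (intro ext)
  fix h k
  show "cnv2 (\<lambda>x y. act x (f y)) (\<lambda>x y. act x (g y)) h k = act h (cnv f g k)"
    by (simp add: cnv2_sw cnv_sw act_sw act_mult sw_swap[of _ k h] flip: sw_def)
qed

lemma cocycle_absorb_right: "cnv2 \<omega> (\<lambda>x y. e (x * y)) = \<omega>"
  by (simp add: fun_eq_iff conv2_def flip: cocycle_absorb)

text \<open>The twisted module axiom at a = 1 carries the absorbed factor from the right of the
  cocycle to its left.\<close>

lemma cocycle_absorb_left: "cnv2 (\<lambda>x y. act x (e y)) \<omega> = \<omega>"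
  by (simp add: fun_eq_iff conv2_def act_twisted flip: cocycle_absorb)

text \<open>The product of a (x) h and b (x) l, with h_1 . b and \<omega>(h_2, l_1) bracketed
  together to fit the shape \<open>pf\<close>. The bracketing of \<open>cop3\<close> is the other
  one; \<open>cls_mu\<close> reconciles them.\<close>

definition mu :: "'a \<Rightarrow> 'h \<Rightarrow> 'a \<Rightarrow> 'h \<Rightarrow> ('a \<times> 'h) \<Rightarrow>\<^sub>0 int" where
  "mu a h b l = pf (lcnv (\<lambda>x. act x b) \<omega>) a h l"

definition mul ::
    "(('a \<times> 'h) \<Rightarrow>\<^sub>0 int) \<Rightarrow> (('a \<times> 'h) \<Rightarrow>\<^sub>0 int) \<Rightarrow> ('a \<times> 'h) \<Rightarrow>\<^sub>0 int" where
  "mul p q = ext2 (\<lambda>a h. ext2 (mu a h) q) p"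

lemma bal2_mu_left: "bal2 sA s N (\<lambda>a h. mu a h b l)"
  unfolding mu_def pf_def
  by (intro bal2_sw)
    (auto simp: bal3_def bilD[OF bil_lcnv] sA_simps algebra_simps cls_frag_add cls_frag_scale'
      H.scale_mult_left intro!: sw_add_mod sw_cong_mod)

lemma bal2_mu_right: "bal2 sA s N (mu a h)"
proof -
  have add: "lcnv (\<lambda>x. act x (b + b')) \<omega> x y =
      lcnv (\<lambda>x. act x b) \<omega> x y + lcnv (\<lambda>x. act x b') \<omega> x y"
    and scale: "lcnv (\<lambda>x. act x (sA c b)) \<omega> x y = sA c (lcnv (\<lambda>x. act x b) \<omega> x y)" for b b' c x y
    by (simp_all add: lcnv_def act_simps distrib_right sw_addf sA_sw sA_simps)
  \<comment> \<open>\<open>bal2_sw\<close> handles the outermost Sweedler sum, so the sum over l is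
    placed outside.\<close>
  have "bal2 sA s N (\<lambda>b l. sw (\<lambda>l1 l2. sw (\<lambda>h1 h2.
      frag_of (a * lcnv (\<lambda>x. act x b) \<omega> h1 l1, h2 * l2)) h) l)"
    by (intro bal2_sw)
      (auto simp: bal3_def bilD[OF bil_lcnv] add scale sA_simps algebra_simps cls_frag_add
        cls_frag_scale' H.scale_mult_right intro!: sw_add_mod sw_cong_mod)
  then show ?thesis
    unfolding mu_def[abs_def] pf_def by (subst sw_swap)
qed

lemma cls_mu:
  "cls N (\<Sum>(h1, h2, h3)\<leftarrow>cop3 s \<Delta> h. \<Sum>(l1, l2)\<leftarrow>cop2 s \<Delta> l.
      frag_of (a * act h1 b * \<omega> h2 l1, h3 * l2)) = cls N (mu a h b l)" (is "?L = _")
proof -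
  have "?L = cls N (sw (\<lambda>h1 x. sw (\<lambda>h2 h3. sw (\<lambda>l1 l2.
      frag_of (a * act h1 b * \<omega> h2 l1, h3 * l2)) l) x) h)"
    by (simp add: cop3_def sw_def case_prod_unfold comp_def sum_list_map_concat)
  also have "\<dots> = cls N (sw (\<lambda>x h3. sw (\<lambda>h1 h2. sw (\<lambda>l1 l2.
      frag_of (a * act h1 b * \<omega> h2 l1, h3 * l2)) l) x) h)"
    by (intro sw_mod_coassoc[symmetric])
      (auto simp: bal3_def act_simps bilD sA_simps algebra_simps cls_frag_add cls_frag_scale'
        H.scale_mult_left intro!: sw_add_mod sw_cong_mod)
  also have "\<dots> = cls N (mu a h b l)"
    unfolding mu_def pf_def lcnv_def mult_sw sw_swap[of _ l]
    by (intro sw_cong_mod) (simp_all add: cls_frag_sw mult.assoc)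
  finally show ?thesis .
qed

lemma cp_mult_cls: "cp_mult s \<Delta> sA act \<omega> (cls N p) (cls N q) = cls N (mul p q)"
proof -
  let ?X = "pres2 sA s (cls N p)" and ?Y = "pres2 sA s (cls N q)"
  have "cp_mult s \<Delta> sA act \<omega> (cls N p) (cls N q) =
      cls N (\<Sum>(a, h)\<leftarrow>?X. \<Sum>(b, l)\<leftarrow>?Y. \<Sum>(h1, h2, h3)\<leftarrow>cop3 s \<Delta> h. \<Sum>(l1, l2)\<leftarrow>cop2 s \<Delta> l.
        frag_of (a * act h1 b * \<omega> h2 l1, h3 * l2))"
    by (simp add: cp_mult_def tens2_cls case_prod_unfold)
  also have "\<dots> = cls N (\<Sum>(a, h)\<leftarrow>?X. \<Sum>(b, l)\<leftarrow>?Y. mu a h b l)"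
    unfolding case_prod_unfold
    by (intro cls_sum_list) (simp_all add: cls_mu[unfolded case_prod_unfold])
  also have "\<dots> = cls N (\<Sum>(a, h)\<leftarrow>?X. ext2 (mu a h) q)"
    unfolding case_prod_unfold
    by (intro cls_sum_list) (simp_all add: sum_pres2[OF _ bal2_mu_right, unfolded case_prod_unfold])
  also have "\<dots> = cls N (mul p q)"
    unfolding mul_def
    by (intro sum_pres2 bal2_fext) (auto simp: case_prod_unfold bal2_mu_left)
  finally show ?thesis .
qed

lemma mul_frag [simp]: "mul (frag_of (a, h)) (frag_of (b, l)) = mu a h b l"
  and mul_sw_right [simp]: "mul (frag_of (a, h)) (sw g l) = sw (\<lambda>x y. mul (frag_of (a, h)) (g x y)) l"
  and mul_sw_left [simp]: "mul (sw g l) q = sw (\<lambda>x y. mul (g x y) q) l"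
  by (simp_all add: mul_def)

text \<open>The coefficient is f(h_1) (h_2 . b g(l_1)) \<omega>(h_3, l_2). Multiplicativity of an
  operator becomes a comparison of such coefficients.\<close>

lemma mul_tau:
  assumes "lin f" "lin g"
  shows "cls N (mul (tau f a h) (tau g b l)) =
    cls N (pf (lcnv f (cnv2 (\<lambda>x y. act x (b * g y)) \<omega>)) a h l)"
proof -
  have bg: "lin (\<lambda>y. b * g y)"
    using assms by (simp add: lin_def sA_simps distrib_left)
  \<comment> \<open>With the inner factor named \<open>G\<close>, the summand is a function of three
    pairs of legs, the shape to which coassociativity of H (x) H applies.\<close>
  define G where "G y = lcnv (\<lambda>x. act x (b * g y)) \<omega>" for y
  have G: "G y z w = sw (\<lambda>t u. act t (b * g y) * \<omega> u w) z" for y z w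
    by (simp add: G_def lcnv_def)
  have bilG: "bil (G y)" for y
    unfolding G_def by auto
  have linG: "lin (\<lambda>y. G y z w)" for z w
    using linD[OF bg] by (simp add: lin_def G act_simps sA_simps distrib_right sw_addf sA_sw)
  have "cls N (mul (tau f a h) (tau g b l)) =
      cls N (sw (\<lambda>x y. sw (\<lambda>p q. sw (\<lambda>h1 h2. sw (\<lambda>l1 l2.
        frag_of (a * f x * G p h1 l1, h2 * l2)) q) y) l) h)"
    by (simp add: tau_def mu_def pf_def G_def)
  also have "\<dots> =
      cls N (sw (\<lambda>y h2. sw (\<lambda>q l2. sw (\<lambda>x h1. sw (\<lambda>p l1.
        frag_of (a * f x * G p h1 l1, h2 * l2)) q) y) l) h)"
    using assms
    by (intro sw2_mod_coassoc[symmetric])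
      (auto simp: bal3_def linD bilD[OF bilG] linD[OF linG] sA_simps algebra_simps cls_frag_add
        cls_frag_scale' H.scale_mult_left H.scale_mult_right)
  also have "\<dots> =
      cls N (sw (\<lambda>y h2. sw (\<lambda>q l2. frag_of (a * sw (\<lambda>x h1. sw (\<lambda>p l1.
        f x * G p h1 l1) q) y, h2 * l2)) l) h)"
    unfolding mult_sw
  proof (intro sw_cong_mod)
    fix y h2 q l2
    show "cls N (sw (\<lambda>x h1. sw (\<lambda>p l1.
        frag_of (a * f x * G p h1 l1, h2 * l2)) q) y) =
      cls N (frag_of (sw (\<lambda>x h1. sw (\<lambda>p l1.
        a * (f x * G p h1 l1)) q) y, h2 * l2))"
      unfolding cls_frag_sw by (intro sw_cong_mod) (simp_all add: cls_frag_sw mult.assoc)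
  qed simp_all
  also have "(\<lambda>y q. sw (\<lambda>x h1. sw (\<lambda>p l1. f x * G p h1 l1) q) y) =
      lcnv f (cnv2 (\<lambda>x y. act x (b * g y)) \<omega>)"
  proof (intro ext)
    fix y q
    show "sw (\<lambda>x h1. sw (\<lambda>p l1. f x * G p h1 l1) q) y =
        lcnv f (cnv2 (\<lambda>x y. act x (b * g y)) \<omega>) y q"
      by (simp add: G lcnv_def cnv2_sw mult_sw sw_times sw_swap[of _ _ q])
  qed
  finally show ?thesis
    by (simp add: pf_def fun_eq_iff)
qed

lemma mul_add_right: "mul p (q + q') = mul p q + mul p q'"
  by (simp add: mul_def case_prod_unfold fext_addf)

lemma mul_fext_left: "mul (fext g p) q = fext (\<lambda>x. mul (g x) q) p"
  by (simp add: mul_def fext_fext)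

lemma mul_fext_right: "mul p (fext g q) = fext (\<lambda>x. mul p (g x)) q"
proof -
  have add: "additive (mul p)"
    by (simp add: additive_def mul_add_right)
  obtain xs ys where "q = formal_sum xs - formal_sum ys"
    using formal_sum_diff_exists by metis
  then show ?thesis
    by (simp add: additive.diff[OF add] additive_sum_list[OF add])
qed

lemma mul_T_T:
  "mul (T f p) (T g q) = ext2 (\<lambda>a h. ext2 (\<lambda>b l. mul (tau f a h) (tau g b l)) q) p"
  unfolding T_def[of f] mul_fext_left unfolding T_def mul_fext_right
  by (simp add: case_prod_unfold)

end

section \<open>Values at the unit of H\<close>

context hopf_pair
begin

lemma cnv2_one_right:
  assumes "bil F" "bil G"
  shows "cnv2 F G h 1 = sw (\<lambda>h1 h2. F h1 1 * G h2 1) h"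
proof -
  have "bal2 s s {0} (\<lambda>k1 k2. F h1 k1 * G h2 k2)" for h1 h2
    using assms by (simp add: bal2_def bilD sA_simps algebra_simps)
  then show ?thesis
    by (simp add: cnv2_sw sw_one)
qed

lemma T_one: "lin f \<Longrightarrow> cls N (tau f a 1) = cls N (frag_of (a * f 1, 1))"
  unfolding tau_def
  by (intro sw_mod_one)
    (auto simp: bal2_def linD sA_simps algebra_simps cls_frag_add cls_frag_scale')

lemma pf_one_right:
  assumes "bil F"
  shows "cls N (pf F a h 1) = cls N (tau (\<lambda>x. F x 1) a h)"
  unfolding pf_def tau_def using assms
  by (intro sw_cong_mod sw_mod_one[where f = "\<lambda>l1 l2. frag_of (a * F _ l1, _ * l2)", simplified])
    (auto simp: bal2_def bilD sA_simps algebra_simps cls_frag_add cls_frag_scale'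
      H.scale_mult_left H.scale_mult_right)

lemma pf_one_left:
  assumes "bil F"
  shows "cls N (pf F a 1 l) = cls N (tau (F 1) a l)"
  unfolding pf_def tau_def sw_swap[of _ l] using assms
  by (intro sw_cong_mod sw_mod_one[where f = "\<lambda>h1 h2. frag_of (a * F h1 _, h2 * _)", simplified])
    (auto simp: bal2_def bilD sA_simps algebra_simps cls_frag_add cls_frag_scale'
      H.scale_mult_left H.scale_mult_right)

end

section \<open>The crossed product as the image of an idempotent\<close>

context symmetric_twisted_partial_action
begin

abbreviation C where
  "C \<equiv> cp_space s \<Delta> sA act \<omega>"

lemma e_one [simp]: "e 1 = 1"
  by (rule act_one)

lemma cnv_e_e [simp]: "cnv e e = e"
  by (simp add: cnv_act)

text \<open>Centrality of f_1 descends to Hom(H, A): lift g to g(h) \<epsilon>(k) and read the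
  identity at k = 1. It lets one half of (ii) imply the other.\<close>

lemma e_central:
  assumes "lin g"
  shows "cnv e g = cnv g e"
proof
  fix h
  define G where "G h k = sA (\<epsilon> k) (g h)" for h k
  have G: "bil G"
    using assms
    by (simp add: G_def bil_def lin_def A.scale_right_distrib A.scale_left_distrib mult.commute)
  then have "cnv2 (f1 \<epsilon> sA act) G = cnv2 G (f1 \<epsilon> sA act)" and F: "bil (f1 \<epsilon> sA act)"
    using f1_central by (auto simp: central2_def hom2_def bil_iff_bilinear_map)
  then have "cnv2 (f1 \<epsilon> sA act) G h 1 = cnv2 G (f1 \<epsilon> sA act) h 1"
    by simp
  then show "cnv e g h = cnv g e h"
    by (simp add: cnv2_one_right F G cnv_sw) (simp add: G_def f1_def H.counit_one)
qed

text \<open>As \<omega>(h, 1) = e(h), right multiplication by 1 (x) 1 has coefficient e * e =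
  e.\<close>

lemma mul_one_right: "cls N (mul p (frag_of (1, 1))) = cls N (T e p)"
proof -
  have "cls N (mu a h 1 1) = cls N (tau e a h)" for a h
  proof -
    have "(\<lambda>x. lcnv e \<omega> x 1) = cnv e e"
      by (simp add: fun_eq_iff lcnv_def cnv_sw cocycle_one_right del: cnv_e_e)
    then show ?thesis
      unfolding mu_def using pf_one_right[of "lcnv e \<omega>" a h] by (simp add: bil_lcnv)
  qed
  then show ?thesis
    unfolding mul_def T_def by (intro fext_cong_mod) auto
qed

lemma mul_one_left: "cls N (mul (frag_of (a, 1)) (frag_of (b, l))) = cls N (tau e (a * b) l)"
proof -
  have "lcnv (\<lambda>x. act x b) \<omega> 1 k = b * e k" for k
  proof -
    have "bal2 s s {0} (\<lambda>x y. act x b * \<omega> y k)"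
      by (simp add: bal2_def bilD act_simps sA_simps algebra_simps)
    then show ?thesis
      by (simp add: lcnv_def sw_one act_one cocycle_one_left)
  qed
  then show ?thesis
    using pf_one_left[of "lcnv (\<lambda>x. act x b) \<omega>" a l]
    by (simp add: mu_def bil_lcnv tau_def mult.assoc)
qed

lemma cp_space_eq: "C = range (\<lambda>p. cls N (T e p))"
proof -
  have "C = (\<lambda>X. cp_mult s \<Delta> sA act \<omega> X (cls N (frag_of (1, 1)))) ` range (cls N)"
    using tensor_space_cls by (auto simp: cp_space_def tens2_cls intro!: image_eqI)
  then show ?thesis
    by (simp add: image_comp comp_def cp_mult_cls mul_one_right)
qed

lemma T_e_cls:
  assumes "cls N p \<in> C"
  shows "cls N (T e p) = cls N p"
proof -
  obtain q where q: "cls N p = cls N (T e q)"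
    using assms by (auto simp: cp_space_eq)
  have "cls N (T e p) = cls N (T e (T e q))"
    by (rule T_cls[OF lin_act q])
  also have "\<dots> = cls N (T e q)"
    by (simp add: T_T)
  finally show ?thesis
    by (simp add: q)
qed

text \<open>The image of an idempotent is its fixed set, so membership becomes an equation that
  convolution identities can settle.\<close>

lemma cls_in_cp_space_iff: "cls N p \<in> C \<longleftrightarrow> cls N (T e p) = cls N p"
  by (metis T_e_cls cp_space_eq rangeI)

lemma cls_T_in_cp_space [simp]: "cls N (T e p) \<in> C"
  by (auto simp: cp_space_eq)

lemma cp_spaceE:
  assumes "X \<in> C"
  obtains p where "X = cls N (T e p)"
  using assms by (auto simp: cp_space_eq)

lemma cls_pres2:
  assumes "X \<in> C"
  shows "cls N (formal_sum (pres2 sA s X)) = X"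
proof -
  obtain p where "X = cls N (T e p)"
    using assms by (rule cp_spaceE)
  then show ?thesis
    by (simp add: pres2_cls)
qed

lemma cp_elem_cls: "cp_elem s \<Delta> sA act a h = cls N (tau e a h)"
  by (simp add: cp_elem_def tens2_cls tau_def sw_def case_prod_unfold)

lemma cp_elem_T: "cp_elem s \<Delta> sA act a h = cls N (T e (frag_of (a, h)))"
  by (simp add: cp_elem_cls)

text \<open>T_e multiplies the coefficient of a product by e(hl) on the right, and the cocycle
  absorbs this factor.\<close>

lemma mul_in_cp_space [simp]: "cls N (mul p q) \<in> C"
proof -
  have "cls N (T e (mu a h b l)) = cls N (mu a h b l)" for a h b l
    using lcnv_cnv2[OF lin_act bil_cocycle bil_comp_mult[OF lin_act, of 1], of b]
    by (simp add: mu_def T_pf bil_lcnv cocycle_absorb_right)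
  then have "cls N (T e (mul p q)) = cls N (mul p q)"
    unfolding mul_def T_def[of e] fext_fext case_prod_unfold
    by (intro fext_cong_mod) (simp_all add: fext_fext flip: T_def[of e, unfolded case_prod_unfold])
  then show ?thesis
    by (simp add: cls_in_cp_space_iff)
qed

end

section \<open>From a twisting pair to an isomorphism\<close>

locale two_partial_actions = hopf_pair s \<Delta> \<epsilon> S sA
    + P: symmetric_twisted_partial_action s \<Delta> \<epsilon> S sA act \<omega>
    + Q: symmetric_twisted_partial_action s \<Delta> \<epsilon> S sA bact \<sigma>
  for s :: "'k::comm_ring_1 \<Rightarrow> 'h::{ring, monoid_mult} \<Rightarrow> 'h"
    and \<Delta> :: "'h \<Rightarrow> ('h, 'h) tensor2" and \<epsilon> :: "'h \<Rightarrow> 'k" and S :: "'h \<Rightarrow> 'h"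
    and sA :: "'k \<Rightarrow> 'a::{ring, monoid_mult} \<Rightarrow> 'a"
    and act bact :: "'h \<Rightarrow> 'a \<Rightarrow> 'a" and \<omega> \<sigma> :: "'h \<Rightarrow> 'h \<Rightarrow> 'a"
begin

text \<open>The element-free form of the conditions. Products are bracketed to the right to match
  \<open>cop3\<close> and \<open>cop4\<close>.\<close>

lemma twisting_pair_iff:
  "twisting_pair s \<Delta> sA act \<omega> bact \<sigma> u v \<longleftrightarrow>
    lin u \<and> lin v \<and> cnv u v = P.e \<and> cnv u P.e = u \<and> cnv P.e u = u \<and>
    (\<forall>a. (\<lambda>h. bact h a) = cnv v (cnv (\<lambda>h. act h a) u)) \<and>
    \<sigma> = lcnv v (cnv2 (\<lambda>h k. act h (v k)) (cnv2 \<omega> (\<lambda>h k. u (h * k))))"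
proof -
  have "(\<Sum>(h1, h2, h3)\<leftarrow>cop3 s \<Delta> h. v h1 * act h2 a * u h3) =
      cnv v (cnv (\<lambda>h. act h a) u) h" for h a
    by (simp add: cop3_def cnv_sw mult_sw)
      (simp add: sw_def case_prod_unfold comp_def sum_list_map_concat mult.assoc)
  moreover have "(\<Sum>(h1, h2, h3, h4)\<leftarrow>cop4 s \<Delta> h. \<Sum>(k1, k2, k3)\<leftarrow>cop3 s \<Delta> k.
        v h1 * act h2 (v k1) * \<omega> h3 k2 * u (h4 * k3)) =
      lcnv v (cnv2 (\<lambda>h k. act h (v k)) (cnv2 \<omega> (\<lambda>h k. u (h * k)))) h k" for h k
  proof -
    have "lcnv v (cnv2 (\<lambda>h k. act h (v k)) (cnv2 \<omega> (\<lambda>h k. u (h * k)))) h k =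
        sw (\<lambda>h1 x. sw (\<lambda>h2 y. sw (\<lambda>h3 h4. sw (\<lambda>k1 z. sw (\<lambda>k2 k3.
          v h1 * act h2 (v k1) * \<omega> h3 k2 * u (h4 * k3)) z) k) y) x) h"
      by (simp add: lcnv_def cnv2_sw mult_sw mult.assoc sw_swap[of _ _ k])
    then show ?thesis
      by (simp add: cop3_def cop4_def)
        (simp add: sw_def case_prod_unfold comp_def sum_list_map_concat)
  qed
  ultimately show ?thesis
    unfolding twisting_pair_def lin_iff_module_hom conv_def[symmetric] fun_eq_iff
    by (simp only:) metis
qed

text \<open>The operator T_(e') comes from the elements a # h of the target; it disappears once u *
  e' = u is known.\<close>

lemma twisting_formula_iff:
  "twisting_formula s \<Delta> sA act bact u \<Phi> \<longleftrightarrow>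
    (\<forall>a h. \<Phi> (cls N (tau P.e a h)) = cls N (T Q.e (tau u a h)))"
proof -
  have "tens_sum sA s [cp_elem s \<Delta> sA bact (a * u h1) h2. (h1, h2) \<leftarrow> cop2 s \<Delta> h] =
      cls N (T Q.e (tau u a h))" for a h
    using tens_sum_cls[of sA s "\<lambda>(x, y). tau Q.e (a * u x) y" "cop2 s \<Delta> h"]
    by (simp add: Q.cp_elem_cls case_prod_unfold tau_def[of u]) (simp add: sw_def case_prod_unfold)
  then show ?thesis
    by (simp add: twisting_formula_def P.cp_elem_cls)
qed

text \<open>Moving u across one action turns it into the other, also when the acted-on element
  depends on a second variable.\<close>

lemma rcnv_act:
  assumes "\<And>a. cnv u (\<lambda>h. bact h a) = cnv (\<lambda>h. act h a) u"
  shows "lcnv u (\<lambda>h k. bact h (g k)) = rcnv (\<lambda>h k. act h (g k)) u"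
  using assms by (simp add: fun_eq_iff lcnv_def rcnv_def cnv_sw)

context
  fixes u v
  assumes pair: "twisting_pair s \<Delta> sA act \<omega> bact \<sigma> u v"
begin

lemma
  shows lin_u: "lin u" and lin_v: "lin v"
    and cnv_u_v: "cnv u v = P.e" and cnv_e_u: "cnv P.e u = u"
    and bact_eq: "(\<lambda>h. bact h a) = cnv v (cnv (\<lambda>h. act h a) u)"
    and sigma_eq: "\<sigma> = lcnv v (cnv2 (\<lambda>h k. act h (v k)) (cnv2 \<omega> (\<lambda>h k. u (h * k))))"
  using pair[unfolded twisting_pair_iff] by blast+

text \<open>Condition (iii) at a = 1 reads e' = v * (e * u), and e * u = u.\<close>

lemma cnv_v_u: "cnv v u = Q.e"
  using bact_eq[of 1] by (simp add: cnv_e_u)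

lemma cnv_u_e: "cnv u Q.e = u"
  by (simp add: cnv_v_u[symmetric] cnv_assoc[symmetric] lin_u lin_v cnv_u_v cnv_e_u)

text \<open>Both sides are v * u * v.\<close>

lemma cnv_v_e: "cnv v P.e = cnv Q.e v"
  by (simp add: cnv_v_u[symmetric] cnv_u_v[symmetric] cnv_assoc lin_u lin_v)

text \<open>Multiply (iii) by u on the left; the resulting u * v = e is absorbed by the
  action.\<close>

lemma cnv_u_bact: "cnv u (\<lambda>h. bact h a) = cnv (\<lambda>h. act h a) u"
proof -
  have "cnv u (\<lambda>h. bact h a) = cnv P.e (cnv (\<lambda>h. act h a) u)"
    by (simp add: bact_eq cnv_assoc[symmetric] lin_u lin_v lin_cnv P.lin_act cnv_u_v[symmetric])
  then show ?thesis
    by (simp add: cnv_assoc[symmetric] lin_u P.cnv_act)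
qed

text \<open>On the left is the coefficient of a product of two values of T_u in the second crossed
  product, on the right that of T_u applied to the product in the first.\<close>

lemma cocycle_exchange:
  "lcnv u (cnv2 (\<lambda>h k. bact h (b * u k)) \<sigma>) =
    cnv2 (lcnv P.e (cnv2 (\<lambda>h k. act h (b * P.e k)) \<omega>)) (\<lambda>h k. u (h * k))"
proof -
  let ?U = "\<lambda>h k. u (h * k)"
  have bu: "lin (\<lambda>k. b * u k)" and be: "lin (\<lambda>k. b * P.e k)"
    using linD[OF lin_u] by (simp_all add: lin_def P.act_simps sA_simps distrib_left)
  note [simp] = lin_u lin_v bu be bil_lcnv bil_cnv2 bil_comp_mult
  \<comment> \<open>The leading v of (iv) cancels against u, leaving e, which the action
    absorbs.\<close>
  have sig: "lcnv u \<sigma> = cnv2 (\<lambda>h k. act h (v k)) (cnv2 \<omega> ?U)"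
  proof -
    have "lcnv u \<sigma> = lcnv P.e (cnv2 (\<lambda>h k. act h (v k)) (cnv2 \<omega> ?U))"
      by (simp add: sigma_eq lcnv_assoc[symmetric] cnv_u_v)
    then show ?thesis
      by (simp add: lcnv_cnv2 P.lcnv_e_act)
  qed
  \<comment> \<open>The neighbours x . b u(y) and x . v(y) merge by \<open>cnv2_act\<close>, so u
    and v cancel once more, now inside the action and in the second variable.\<close>
  have buv: "cnv (\<lambda>k. b * u k) v = (\<lambda>k. b * P.e k)"
    using fun_cong[OF cnv_u_v] by (simp add: fun_eq_iff cnv_sw mult.assoc flip: mult_sw)
  have "lcnv u (cnv2 (\<lambda>h k. bact h (b * u k)) \<sigma>) =
      cnv2 (\<lambda>h k. act h (b * u k)) (lcnv u \<sigma>)"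
    by (simp add: lcnv_cnv2 rcnv_act[OF cnv_u_bact] rcnv_cnv2)
  also have "\<dots> = cnv2 (\<lambda>h k. act h (b * P.e k)) (cnv2 \<omega> ?U)"
    by (simp add: sig cnv2_assoc[symmetric] P.cnv2_act buv)
  also have "\<dots> = cnv2 (lcnv P.e (cnv2 (\<lambda>h k. act h (b * P.e k)) \<omega>)) ?U"
    by (simp add: lcnv_cnv2 P.lcnv_e_act cnv2_assoc)
  finally show ?thesis .
qed

lemma T_u_mul: "cls N (T u (P.mul (T P.e p) (T P.e q))) = cls N (Q.mul (T u p) (T u q))"
proof -
  have bu: "lin (\<lambda>k. b * u k)" and be: "lin (\<lambda>k. b * P.e k)" for b
    using linD[OF lin_u] by (simp_all add: lin_def P.act_simps sA_simps distrib_left)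
  note [simp] = lin_u bu be bil_lcnv bil_cnv2
  have "cls N (T u (P.mul (tau P.e a h) (tau P.e b l))) =
      cls N (Q.mul (tau u a h) (tau u b l))" for a h b l
  proof -
    have "cls N (T u (P.mul (tau P.e a h) (tau P.e b l))) =
        cls N (T u (pf (lcnv P.e (cnv2 (\<lambda>x y. act x (b * P.e y)) \<omega>)) a h l))"
      by (intro T_cls P.mul_tau) simp_all
    then show ?thesis
      by (simp add: T_pf Q.mul_tau cocycle_exchange)
  qed
  then show ?thesis
    unfolding P.mul_T_T Q.mul_T_T unfolding case_prod_unfold T_def fext_fext
    by (intro fext_cong_mod) (simp_all add: T_def case_prod_unfold)
qed

lemma T_u_in_cp_space: "cls N (T u p) \<in> Q.C"
  by (simp add: Q.cls_in_cp_space_iff T_T lin_u cnv_u_e)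

text \<open>The coefficient e' * v equals v * e, and a further e on the right does not change
  it.\<close>

lemma T_v_in_cp_space: "cls N (T v (T Q.e p)) \<in> P.C"
proof -
  have "cls N (T P.e (T v (T Q.e p))) = cls N (T P.e (T (cnv Q.e v) p))"
    by (intro T_cls T_T) (simp_all add: lin_v)
  also have "\<dots> = cls N (T (cnv (cnv v P.e) P.e) p)"
    by (simp add: T_T lin_v lin_cnv cnv_v_e)
  also have "cnv (cnv v P.e) P.e = cnv v P.e"
    by (simp add: cnv_assoc lin_v)
  also have "cls N (T (cnv v P.e) p) = cls N (T v (T Q.e p))"
    by (simp add: T_T lin_v cnv_v_e)
  finally show ?thesis
    by (simp only: P.cls_in_cp_space_iff)
qed

lemma twisting_pair_imp_iso:
  assumes "u 1 = 1"
  shows "\<exists>\<Phi>. twisting_formula s \<Delta> sA act bact u \<Phi> \<and> cp_algebra_iso s \<Delta> sA act \<omega> bact \<sigma> \<Phi>"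
proof -
  \<comment> \<open>\<open>T f\<close> as a map on tensors; linearity of f removes the dependence on
    the chosen list.\<close>
  define M where "M f X = cls N (T f (formal_sum (pres2 sA s X)))" for f X
  have M: "M f (cls N p) = cls N (T f p)" if "lin f" for f p
    unfolding M_def by (intro T_cls that pres2_cls)
  have Mu [simp]: "M u (cls N p) = cls N (T u p)" and Mv [simp]: "M v (cls N p) = cls N (T v p)" for p
    by (simp_all add: M lin_u lin_v)
  have ue [simp]: "cls N (T u (T P.e p)) = cls N (T u p)" for p
    by (simp add: T_T lin_u cnv_e_u)
  have ue' [simp]: "cls N (T Q.e (T u p)) = cls N (T u p)" for p
    by (simp add: T_T lin_u cnv_u_e)
  have "twisting_formula s \<Delta> sA act bact u (M u)"
    unfolding twisting_formula_iff
  proof (intro allI)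
    fix a h
    show "M u (cls N (tau P.e a h)) = cls N (T Q.e (tau u a h))"
      using ue[of "frag_of (a, h)"] ue'[of "frag_of (a, h)"] by simp
  qed
  moreover have "bij_betw (M u) P.C Q.C"
  proof (rule bij_betw_byWitness[where f' = "M v"])
    have "cls N (T v (T u p)) = cls N (T P.e p)" for p
      by (simp add: T_T lin_u lin_v cnv_u_v)
    moreover have "cls N (T v (T u (T P.e p))) = cls N (T v (T u p))" for p
      by (intro T_cls lin_v ue)
    ultimately show "\<forall>X\<in>P.C. M v (M u X) = X"
      by (auto elim!: P.cp_spaceE)
    show "\<forall>X\<in>Q.C. M u (M v X) = X"
    proof
      fix X
      assume "X \<in> Q.C"
      then obtain p where X: "X = cls N (T Q.e p)"
        by (rule Q.cp_spaceE)
      have "cls N (T u (T v (T Q.e p))) = cls N (T Q.e (T Q.e p))"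
        by (simp add: T_T lin_u lin_v cnv_v_u)
      then show "M u (M v X) = X"
        by (simp add: X T_T)
    qed
    show "M u ` P.C \<subseteq> Q.C"
      by (auto elim!: P.cp_spaceE simp: T_u_in_cp_space)
    show "M v ` Q.C \<subseteq> P.C"
      by (auto elim!: Q.cp_spaceE simp: T_v_in_cp_space)
  qed
  moreover have "M u (tens_sum sA s [X, Y]) = tens_sum sA s [M u X, M u Y]"
    if "X \<in> P.C" "Y \<in> P.C" for X Y
    using that by (auto elim!: P.cp_spaceE simp: tens_sum_pair simp del: ue)
  moreover have "M u (tens_scale sA s c X) = tens_scale sA s c (M u X)" if "X \<in> P.C" for c X
    using that by (auto elim!: P.cp_spaceE simp: tens_scale_cls T_scl simp del: ue)
  moreover have "M u (cp_mult s \<Delta> sA act \<omega> X Y) = cp_mult s \<Delta> sA bact \<sigma> (M u X) (M u Y)"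
    if "X \<in> P.C" "Y \<in> P.C" for X Y
    using that by (auto elim!: P.cp_spaceE simp: P.cp_mult_cls Q.cp_mult_cls T_u_mul)
  \<comment> \<open>T_u sends 1 (x) 1 to u(1) (x) 1, so the normalization of u preserves the
    unit.\<close>
  moreover have "M u (cp_elem s \<Delta> sA act 1 1) = cp_elem s \<Delta> sA bact 1 1"
    using ue[of "frag_of (1, 1)"] assms
    by (simp add: P.cp_elem_cls Q.cp_elem_cls T_one lin_u)
  ultimately show ?thesis
    unfolding cp_algebra_iso_def by blast
qed

end

end

section \<open>Colinear maps between crossed products\<close>

context hopf_pair
begin

abbreviation N3 :: "(('a \<times> 'h \<times> 'h) \<Rightarrow>\<^sub>0 int) set" where
  "N3 \<equiv> null3 sA s s"

lemmas cls_frag3_add = null3_rules(1,2,3)[of sA s s]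
  and cls_frag3_scale = null3_rules(4,5)[of sA s s]

lemma bal3_frag_of: "bal3 sA s s N3 (\<lambda>a x y. frag_of (a, x, y))"
  by (simp add: bal3_def cls_frag3_add cls_frag3_scale)

definition coact :: "(('a \<times> 'h) \<Rightarrow>\<^sub>0 int) \<Rightarrow> ('a \<times> 'h \<times> 'h) \<Rightarrow>\<^sub>0 int" where
  "coact = ext2 (\<lambda>a h. sw (\<lambda>x y. frag_of (a, x, y)) h)"

lemma coaction_cls: "coaction s \<Delta> sA (cls N p) = cls N3 (coact p)"
proof -
  have "cls N3 (\<Sum>(a, h)\<leftarrow>pres2 sA s (cls N p). sw (\<lambda>x y. frag_of (a, x, y)) h) = cls N3 (coact p)"
    unfolding coact_def by (intro sum_pres2 bal2_sw bal3_frag_of) simp_all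
  then show ?thesis
    by (simp add: coaction_def tens3_cls sw_def case_prod_unfold)
qed

text \<open>A representative of p (x) h in A (x) H (x) H.\<close>

definition put :: "'h \<Rightarrow> (('a \<times> 'h) \<Rightarrow>\<^sub>0 int) \<Rightarrow> ('a \<times> 'h \<times> 'h) \<Rightarrow>\<^sub>0 int" where
  "put h = ext2 (\<lambda>a l. frag_of (a, l, h))"

lemma put_frag [simp]: "put h (frag_of (a, l)) = frag_of (a, l, h)"
  and put_add [simp]: "put h (p + q) = put h p + put h q"
  and put_sw [simp]: "put h (sw f x) = sw (\<lambda>x y. put h (f x y)) x"
  by (simp_all add: put_def)

lemma bal2_put: "bal2 sA s N3 (\<lambda>a l. frag_of (a, l, h))"
  by (simp add: bal2_def cls_frag3_add cls_frag3_scale(1))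

lemma put_cls: "cls N p = cls N q \<Longrightarrow> cls N3 (put h p) = cls N3 (put h q)"
  unfolding put_def by (rule ext2_cls[OF _ bal2_put]) simp_all

lemma put_plus: "cls N3 (put (h + h') p) = cls N3 (put h p + put h' p)"
  unfolding put_def fext_addf[symmetric]
  by (intro fext_cong_mod) (auto simp: cls_frag3_add)

lemma put_scl: "cls N3 (put h (scl c p)) = cls N3 (put (s c h) p)"
  unfolding put_def scl_def fext_fext
  by (intro fext_cong_mod) (auto simp: cls_frag3_scale)

lemma join_tens_cls:
  "join_tens s sA Xs = cls N3 (\<Sum>(X, h)\<leftarrow>Xs. put h (formal_sum (pres2 sA s X)))"
  by (simp add: join_tens_def tens3_cls put_def case_prod_unfold)

text \<open>The map I (x) \<epsilon> (x) I. By the counit axiom it undoes the coaction, while X (x)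
  h goes to \<open>ev\<close> of X tensored with h; comparing the two determines a colinear
  map.\<close>

definition contract :: "(('a \<times> 'h \<times> 'h) \<Rightarrow>\<^sub>0 int) \<Rightarrow> ('a \<times> 'h) \<Rightarrow>\<^sub>0 int" where
  "contract = ext3 (\<lambda>a x y. frag_of (sA (\<epsilon> x) a, y))"

lemma contract_cls: "cls N3 p = cls N3 q \<Longrightarrow> cls N (contract p) = cls N (contract q)"
  unfolding contract_def
  by (rule ext3_cls[where sL = sA and sM = s and sN = s])
    (auto simp: bal3_def cls_frag_add cls_frag_scale' A.scale_right_distrib
      A.scale_left_distrib mult.commute)

lemma contract_sw [simp]: "contract (sw f h) = sw (\<lambda>x y. contract (f x y)) h"
  by (simp add: contract_def)

lemma contract_coact: "cls N (contract (coact p)) = cls N p"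
proof -
  have "cls N (sw (\<lambda>x y. frag_of (sA (\<epsilon> x) a, y)) h) = cls N (frag_of (a, h))" for a h
  proof -
    have "cls N (sw (\<lambda>x y. frag_of (sA (\<epsilon> x) a, y)) h) =
        cls N (sw (\<lambda>x y. frag_of (a, s (\<epsilon> x) y)) h)"
      by (intro sw_cong_mod) (simp_all add: cls_frag_scale)
    also have "\<dots> = cls N (frag_of (a, sw (\<lambda>x y. s (\<epsilon> x) y) h))"
      by (rule sw_add_mod_apply[symmetric, where f = "\<lambda>x. frag_of (a, x)"])
        (simp_all add: add_mod_def cls_frag_add)
    finally show ?thesis
      using H.counit_left[of h] by (simp add: sw_def)
  qed
  then have "cls N (contract (coact p)) = cls N (fext frag_of p)"
    unfolding contract_def coact_def fext_fext by (intro fext_cong_mod) auto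
  also have "fext frag_of p = p"
    using formal_sum_diff_exists[of p] by (auto simp flip: formal_sum_def)
  finally show ?thesis .
qed

lemma contract_put: "cls N (contract (put h p)) = cls N (frag_of (ev p, h))"
proof -
  have "add_mod N (\<lambda>a. frag_of (a, h))"
    by (simp add: add_mod_def cls_frag_add)
  then have add: "add_mod N (\<lambda>p. frag_of (ev p, h))"
    by (simp add: add_mod_def)
  show ?thesis
    unfolding add_mod_fext[OF _ add, of p, simplified] contract_def put_def fext_fext
    by (simp add: case_prod_unfold ev_def)
qed

text \<open>Left multiplication of the first factor; on the crossed product it is the left A-module
  structure, by \<open>cp_mult_left\<close>.\<close>

definition lmul :: "'a \<Rightarrow> (('a \<times> 'h) \<Rightarrow>\<^sub>0 int) \<Rightarrow> ('a \<times> 'h) \<Rightarrow>\<^sub>0 int" where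
  "lmul a = ext2 (\<lambda>b h. frag_of (a * b, h))"

lemma lmul_frag [simp]: "lmul a (frag_of (b, h)) = frag_of (a * b, h)"
  by (simp add: lmul_def)

lemma lmul_cls: "cls N p = cls N q \<Longrightarrow> cls N (lmul a p) = cls N (lmul a q)"
  unfolding lmul_def
  by (rule ext2_cls[where sM = sA and sN = s])
    (auto simp: bal2_def distrib_left sA_simps cls_frag_add cls_frag_scale')

lemma T_lmul: "T f (lmul a p) = lmul a (T f p)"
  unfolding T_def lmul_def fext_fext
  by (rule arg_cong[where f = "\<lambda>f. fext f p"]) (auto simp: tau_def mult.assoc)

lemma ev_lmul: "ev (lmul a p) = a * ev p"
proof -
  have "additive ((*) a)"
    by (simp add: additive_def distrib_left)
  moreover obtain xs ys where "p = formal_sum xs - formal_sum ys"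
    using formal_sum_diff_exists by metis
  ultimately show ?thesis
    by (simp add: ev_def lmul_def fext_fext case_prod_unfold right_diff_distrib
        additive_sum_list A.scale_mult_right)
qed

end

lemma (in symmetric_twisted_partial_action) cp_mult_left:
  "cp_mult s \<Delta> sA act \<omega> (cp_elem s \<Delta> sA act a 1) (cls N p) = cls N (lmul a (T e p))"
proof -
  have "cls N (tau e a 1) = cls N (frag_of (a, 1))"
    using T_one[of e a] by simp
  then have "cp_mult s \<Delta> sA act \<omega> (cp_elem s \<Delta> sA act a 1) (cls N p) =
      cls N (mul (frag_of (a, 1)) p)"
    by (simp add: cp_elem_cls cp_mult_cls)
  also have "\<dots> = cls N (fext (\<lambda>x. mul (frag_of (a, 1)) (frag_of x)) p)"
    by (intro add_mod_fext) (simp_all add: add_mod_def mul_add_right)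
  also have "\<dots> = cls N (T e (lmul a p))"
    unfolding T_def lmul_def fext_fext
    by (intro fext_cong_mod) (auto simp: mul_one_left simp del: mul_frag)
  finally show ?thesis
    by (simp add: T_lmul)
qed

section \<open>Linear maps between crossed products and their extension \<Phi> (x) I\<close>

locale cp_linear_map = two_partial_actions s \<Delta> \<epsilon> S sA act bact \<omega> \<sigma>
  for s :: "'k::comm_ring_1 \<Rightarrow> 'h::{ring, monoid_mult} \<Rightarrow> 'h"
    and \<Delta> :: "'h \<Rightarrow> ('h, 'h) tensor2" and \<epsilon> :: "'h \<Rightarrow> 'k" and S :: "'h \<Rightarrow> 'h"
    and sA :: "'k \<Rightarrow> 'a::{ring, monoid_mult} \<Rightarrow> 'a"
    and act bact :: "'h \<Rightarrow> 'a \<Rightarrow> 'a" and \<omega> \<sigma> :: "'h \<Rightarrow> 'h \<Rightarrow> 'a" +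
  fixes \<Phi> :: "('a, 'h) tensor2 \<Rightarrow> ('a, 'h) tensor2"
  assumes closed: "X \<in> P.C \<Longrightarrow> \<Phi> X \<in> Q.C"
    and add: "X \<in> P.C \<Longrightarrow> Y \<in> P.C \<Longrightarrow> \<Phi> (tens_sum sA s [X, Y]) = tens_sum sA s [\<Phi> X, \<Phi> Y]"
    and scale: "X \<in> P.C \<Longrightarrow> \<Phi> (tens_scale sA s c X) = tens_scale sA s c (\<Phi> X)"
begin

text \<open>A representative of \<Phi> T_e p. Composing with the projection T_e makes it available
  on all of A (x) H.\<close>

definition lift :: "(('a \<times> 'h) \<Rightarrow>\<^sub>0 int) \<Rightarrow> ('a \<times> 'h) \<Rightarrow>\<^sub>0 int" where
  "lift p = formal_sum (pres2 sA s (\<Phi> (cls N (T P.e p))))"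

lemma cls_lift: "cls N (lift p) = \<Phi> (cls N (T P.e p))"
  unfolding lift_def by (intro Q.cls_pres2 closed P.cls_T_in_cp_space)

text \<open>Congruent arguments give the same coset to present, so even the chosen representatives
  coincide.\<close>

lemma lift_cls: "cls N p = cls N q \<Longrightarrow> lift p = lift q"
  using T_cls[OF P.lin_act, of p q] by (simp add: lift_def)

lemma lift_T_e: "lift (T P.e p) = lift p"
  by (simp add: lift_def T_T)

lemma add_mod_lift: "add_mod N lift"
  unfolding add_mod_def
proof (intro allI)
  fix p q
  have "\<Phi> (tens_sum sA s [cls N (T P.e p), cls N (T P.e q)]) =
      tens_sum sA s [cls N (lift p), cls N (lift q)]"
    by (simp add: add cls_lift)
  then show "cls N (lift (p + q)) = cls N (lift p + lift q)"
    by (simp only: tens_sum_pair cls_lift[of "p + q"] T_add)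
qed

lemma lift_scl: "cls N (lift (scl c p)) = cls N (scl c (lift p))"
proof -
  have "\<Phi> (tens_scale sA s c (cls N (T P.e p))) = tens_scale sA s c (cls N (lift p))"
    by (simp add: scale cls_lift)
  then show ?thesis
    by (simp only: tens_scale_cls cls_lift[of "scl c p"] T_scl)
qed

lemma lift_fext: "cls N (lift p) = cls N (ext2 (\<lambda>a h. lift (frag_of (a, h))) p)"
  using add_mod_fext[OF _ add_mod_lift] by (simp add: case_prod_unfold)

text \<open>Represents \<Phi> T_e (x) I on the pure tensor a (x) l (x) h.\<close>

definition push :: "'a \<Rightarrow> 'h \<Rightarrow> 'h \<Rightarrow> ('a \<times> 'h \<times> 'h) \<Rightarrow>\<^sub>0 int" where
  "push a l h = put h (lift (frag_of (a, l)))"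

lemma bal3_push: "bal3 sA s s N3 push"
  unfolding bal3_def
proof (intro conjI allI)
  fix a a' l l' h h' c
  have lift_add: "cls N (lift (p + q)) = cls N (lift p + lift q)" for p q
    using add_mod_lift by (simp add: add_mod_def)
  have "cls N (lift (frag_of (a + a', l))) = cls N (lift (frag_of (a, l)) + lift (frag_of (a', l)))"
    using lift_cls[OF cls_frag_add(1)] lift_add by simp
  from put_cls[OF this] show "cls N3 (push (a + a') l h) = cls N3 (push a l h + push a' l h)"
    by (simp add: push_def)
  have "cls N (lift (frag_of (a, l + l'))) = cls N (lift (frag_of (a, l)) + lift (frag_of (a, l')))"
    using lift_cls[OF cls_frag_add(2)] lift_add by simp
  from put_cls[OF this] show "cls N3 (push a (l + l') h) = cls N3 (push a l h + push a l' h)"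
    by (simp add: push_def)
  show "cls N3 (push a l (h + h')) = cls N3 (push a l h + push a l h')"
    by (simp add: push_def put_plus)
  show "cls N3 (push (sA c a) l h) = cls N3 (push a (s c l) h)"
    using lift_cls[OF cls_frag_scale] by (simp add: push_def)
  \<comment> \<open>Moving a scalar to the third factor is where linearity of \<Phi> over the base
    ring enters.\<close>
  have "lift (frag_of (a, s c l)) = lift (scl c (frag_of (a, l)))"
    by (intro lift_cls) (simp add: scl_def cls_frag_scale)
  then have "cls N (lift (frag_of (a, s c l))) = cls N (scl c (lift (frag_of (a, l))))"
    by (simp add: lift_scl)
  from put_cls[OF this] show "cls N3 (push a (s c l) h) = cls N3 (push a l (s c h))"
    by (simp add: push_def put_scl)
qed

text \<open>T_e fixes the entries from C, so applying \<Phi> entry by entry agrees with \<Phi> T_e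
  (x) I on the joined tensor.\<close>

lemma join_tens_map:
  assumes "fst ` set Xs \<subseteq> P.C"
  shows "join_tens s sA (map (apfst \<Phi>) Xs) =
    cls N3 (ext3 push (\<Sum>(X, h)\<leftarrow>Xs. put h (formal_sum (pres2 sA s X))))"
proof -
  have "cls N3 (put h (formal_sum (pres2 sA s (\<Phi> X)))) =
      cls N3 (ext3 push (put h (formal_sum (pres2 sA s X))))" if "X \<in> P.C" for X h
  proof -
    let ?p = "formal_sum (pres2 sA s X)"
    have X: "cls N ?p = X"
      by (rule P.cls_pres2[OF that])
    then have "\<Phi> X = cls N (lift ?p)"
      using that P.T_e_cls[of ?p] by (simp add: cls_lift)
    then have "cls N (formal_sum (pres2 sA s (\<Phi> X))) =
        cls N (ext2 (\<lambda>a h. lift (frag_of (a, h))) ?p)"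
      by (simp only: pres2_cls lift_fext)
    then have "cls N3 (put h (formal_sum (pres2 sA s (\<Phi> X)))) =
        cls N3 (put h (ext2 (\<lambda>a h. lift (frag_of (a, h))) ?p))"
      by (rule put_cls)
    also have "put h (ext2 (\<lambda>a h. lift (frag_of (a, h))) ?p) = ext3 push (put h ?p)"
      unfolding put_def fext_fext by (simp add: case_prod_unfold push_def put_def)
    finally show ?thesis .
  qed
  then have "cls N3 (\<Sum>(X, h)\<leftarrow>Xs. put h (formal_sum (pres2 sA s (\<Phi> X)))) =
      cls N3 (\<Sum>(X, h)\<leftarrow>Xs. ext3 push (put h (formal_sum (pres2 sA s X))))"
    using assms by (intro cls_sum_list) (auto simp: case_prod_unfold image_subset_iff)
  then show ?thesis
    by (simp add: join_tens_cls comp_def case_prod_unfold)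
qed

text \<open>Since \<open>push\<close> is balanced, two presentations of one tensor by elements of C
  have the same image; the choice in \<open>map_tens_id\<close> is harmless.\<close>

lemma map_tens_id_join:
  assumes "fst ` set Xs \<subseteq> P.C"
  shows "map_tens_id s sA P.C \<Phi> (join_tens s sA Xs) = join_tens s sA (map (apfst \<Phi>) Xs)"
proof -
  define Ys where "Ys = (SOME Ys. fst ` set Ys \<subseteq> P.C \<and> join_tens s sA Ys = join_tens s sA Xs)"
  have Ys: "fst ` set Ys \<subseteq> P.C \<and> join_tens s sA Ys = join_tens s sA Xs"
    unfolding Ys_def by (rule someI[of _ Xs]) (simp add: assms)
  then have "join_tens s sA (map (apfst \<Phi>) Ys) = join_tens s sA (map (apfst \<Phi>) Xs)"
    unfolding join_tens_map[OF assms] join_tens_map[OF conjunct1[OF Ys]]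
    by (intro ext3_cls[OF _ bal3_push]) (simp_all add: join_tens_cls)
  then show ?thesis
    by (simp add: map_tens_id_def flip: Ys_def)
qed

end

text \<open>The coaction sends a # h to the sum of (a # h_1) (x) h_2, by coassociativity; this
  exhibits its values in C (x) H.\<close>

lemma (in symmetric_twisted_partial_action) coaction_join:
  fixes ps :: "('c \<times> 'b) list"
  defines "Xs \<equiv> [(cp_elem s \<Delta> sA act a x, y). (a, h) \<leftarrow> ps, (x, y) \<leftarrow> cop2 s \<Delta> h]"
  shows "coaction s \<Delta> sA (cls N (T e (formal_sum ps))) = join_tens s sA Xs"
    and "fst ` set Xs \<subseteq> C"
proof -
  have *: "cls N3 (coact (tau e a h)) = cls N3 (sw (\<lambda>x y. put y (tau e a x)) h)" for a h
  proof -
    have "cls N3 (coact (tau e a h)) =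
        cls N3 (sw (\<lambda>x y. sw (\<lambda>z w. frag_of (a * e x, z, w)) y) h)"
      by (simp add: tau_def coact_def)
    also have "\<dots> = cls N3 (sw (\<lambda>x y. put y (tau e a x)) h)"
      unfolding tau_def put_sw put_frag
      by (intro sw_mod_coassoc[symmetric])
        (auto simp: bal3_def act_simps sA_simps algebra_simps cls_frag3_add cls_frag3_scale)
    finally show ?thesis .
  qed
  have **: "cls N3 (put y (formal_sum (pres2 sA s (cp_elem s \<Delta> sA act a x)))) =
      cls N3 (put y (tau e a x))" for a x y
    by (intro put_cls) (simp add: cp_elem_cls pres2_cls)
  have "join_tens s sA Xs = cls N3 (\<Sum>(a, h)\<leftarrow>ps. sw (\<lambda>x y.
      put y (formal_sum (pres2 sA s (cp_elem s \<Delta> sA act a x)))) h)"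
    by (simp add: join_tens_cls Xs_def sw_def case_prod_unfold comp_def sum_list_map_concat)
  also have "\<dots> = cls N3 (\<Sum>(a, h)\<leftarrow>ps. coact (tau e a h))"
  proof (intro cls_sum_list subgrp_null3)
    have "cls N3 (sw (\<lambda>x y. put y (formal_sum (pres2 sA s (cp_elem s \<Delta> sA act a x)))) h) =
        cls N3 (coact (tau e a h))" for a h
      unfolding * by (intro sw_cong_mod subgrp_null3 **)
    then show "cls N3 (case z of (a, h) \<Rightarrow>
          sw (\<lambda>x y. put y (formal_sum (pres2 sA s (cp_elem s \<Delta> sA act a x)))) h) =
        cls N3 (case z of (a, h) \<Rightarrow> coact (tau e a h))" for z
      by (cases z) simp
  qed
  also have "\<dots> = cls N3 (coact (T e (formal_sum ps)))"
    by (simp add: T_def coact_def case_prod_unfold)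
  finally show "coaction s \<Delta> sA (cls N (T e (formal_sum ps))) = join_tens s sA Xs"
    by (simp add: coaction_cls)
  show "fst ` set Xs \<subseteq> C"
    by (auto simp: Xs_def cp_elem_T simp del: T_frag)
qed

section \<open>The coefficient function of a module and comodule map\<close>

locale cp_colinear_map = cp_linear_map +
  assumes module_map: "cp_module_map s \<Delta> sA act \<omega> bact \<sigma> \<Phi>"
    and comodule_map: "cp_comodule_map s \<Delta> sA act \<omega> \<Phi>"
begin

definition coeff :: "'b \<Rightarrow> 'c" where
  "coeff h = ev (lift (frag_of (1, h)))"

lemma lift_lmul: "cls N (lift (lmul a p)) = cls N (lmul a (lift p))"
proof -
  have "\<Phi> (cls N (T P.e (lmul a (T P.e p)))) =
      cp_mult s \<Delta> sA bact \<sigma> (cp_elem s \<Delta> sA bact a 1) (cls N (lift p))"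
    using module_map P.cls_T_in_cp_space[of p]
    unfolding cp_module_map_def cls_lift
    by (metis P.cp_mult_left T_lmul)
  also have "\<dots> = cls N (lmul a (lift p))"
  proof -
    have "cls N (T Q.e (lift p)) = cls N (lift p)"
      by (intro Q.T_e_cls) (simp add: cls_lift closed)
    then show ?thesis
      unfolding Q.cp_mult_left by (rule lmul_cls)
  qed
  also have "\<Phi> (cls N (T P.e (lmul a (T P.e p)))) = cls N (lift (lmul a p))"
    by (simp add: T_lmul[symmetric] lift_T_e flip: cls_lift)
  finally show ?thesis .
qed

lemma ev_lift_frag: "ev (lift (frag_of (a, h))) = a * coeff h"
  using ev_cls[OF lift_lmul[of a "frag_of (1, h)"]] by (simp add: ev_lmul coeff_def)

text \<open>Contract both sides of the colinearity equation: one returns \<Phi>(a # h), the other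
  becomes the sum of a u(h_1) (x) h_2.\<close>

lemma lift_frag: "cls N (lift (frag_of (a, h))) = cls N (tau coeff a h)"
proof -
  let ?Xs = "[(cp_elem s \<Delta> sA act a x, y). (x, y) \<leftarrow> cop2 s \<Delta> h]"
  have "cls N3 (coact (lift (frag_of (a, h)))) =
      coaction s \<Delta> sA (\<Phi> (cls N (T P.e (frag_of (a, h)))))"
    by (simp only: coaction_cls[symmetric] cls_lift)
  also have "\<dots> = map_tens_id s sA P.C \<Phi> (coaction s \<Delta> sA (cls N (T P.e (frag_of (a, h)))))"
    using comodule_map P.cls_T_in_cp_space unfolding cp_comodule_map_def by blast
  also have "\<dots> = join_tens s sA (map (apfst \<Phi>) ?Xs)"
    using P.coaction_join[of "[(a, h)]"] map_tens_id_join[of ?Xs] by simp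
  also have "\<dots> = cls N3 (sw (\<lambda>x y. put y (lift (frag_of (a, x)))) h)"
    by (simp add: join_tens_cls sw_def case_prod_unfold comp_def lift_def P.cp_elem_T)
  finally have "cls N (contract (coact (lift (frag_of (a, h))))) =
      cls N (contract (sw (\<lambda>x y. put y (lift (frag_of (a, x)))) h))"
    by (rule contract_cls)
  also have "\<dots> = cls N (tau coeff a h)"
    unfolding contract_sw tau_def
    by (intro sw_cong_mod) (simp_all add: contract_put ev_lift_frag)
  finally show ?thesis
    by (simp add: contract_coact)
qed

lemma map_eq: "\<Phi> (cls N (T P.e p)) = cls N (T coeff p)"
proof -
  have "cls N (lift p) = cls N (T coeff p)"
    unfolding lift_fext T_def by (intro fext_cong_mod) (auto simp: lift_frag)
  then show ?thesis
    by (simp add: cls_lift)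
qed

lemma lin_coeff: "lin coeff"
proof -
  have "ev (lift (frag_of (1, x + y))) = ev (lift (frag_of (1, x)) + lift (frag_of (1, y)))" for x y
    using add_mod_lift lift_cls[OF cls_frag_add(2)] by (intro ev_cls) (simp add: add_mod_def)
  moreover have "ev (lift (frag_of (1, s c x))) = ev (scl c (lift (frag_of (1, x))))" for c x
  proof -
    have "lift (frag_of (1, s c x)) = lift (scl c (frag_of (1, x)))"
      by (intro lift_cls) (simp add: scl_def cls_frag_scale)
    then show ?thesis
      by (simp add: ev_cls[OF lift_scl])
  qed
  ultimately show ?thesis
    by (simp add: lin_def coeff_def ev_scl)
qed

text \<open>\<open>lift\<close> factors through T_e, so e is absorbed on the left. Dually, that
  \<Phi> lands in the image of T_(e') yields \<open>cnv_coeff_e\<close>.\<close>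

lemma cnv_e_coeff: "cnv P.e coeff = coeff"
proof
  fix h
  have "coeff h = ev (lift (T P.e (frag_of (1, h))))"
    by (simp only: lift_T_e coeff_def)
  also have "\<dots> = ev (T coeff (T P.e (frag_of (1, h))))"
    by (intro ev_cls) (simp only: cls_lift map_eq)
  also have "\<dots> = ev (T (cnv P.e coeff) (frag_of (1, h)))"
    by (intro ev_cls T_T P.lin_act lin_coeff)
  also have "\<dots> = cnv P.e coeff h"
    using lin_coeff by (simp add: lin_cnv)
  finally show "cnv P.e coeff h = coeff h"
    by simp
qed

lemma cnv_coeff_e: "cnv coeff Q.e = coeff"
proof
  fix h
  have "cls N (T coeff (frag_of (1, h))) \<in> Q.C"
    using closed[OF P.cls_T_in_cp_space] by (simp only: map_eq)
  then have "ev (T coeff (frag_of (1, h))) = ev (T Q.e (T coeff (frag_of (1, h))))"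
    by (intro ev_cls) (simp only: Q.T_e_cls)
  also have "\<dots> = ev (T (cnv coeff Q.e) (frag_of (1, h)))"
    by (intro ev_cls T_T Q.lin_act lin_coeff)
  finally show "cnv coeff Q.e h = coeff h"
    using lin_coeff by (simp add: lin_cnv)
qed

end

section \<open>From an isomorphism to a twisting pair\<close>

context two_partial_actions
begin

lemma iso_imp_twisting_pair:
  assumes iso: "cp_algebra_iso s \<Delta> sA act \<omega> bact \<sigma> \<Phi>"
    and module_map: "cp_module_map s \<Delta> sA act \<omega> bact \<sigma> \<Phi>"
    and comodule_map: "cp_comodule_map s \<Delta> sA act \<omega> \<Phi>"
  shows "\<exists>u v. twisting_pair s \<Delta> sA act \<omega> bact \<sigma> u v \<and> twisting_formula s \<Delta> sA act bact u \<Phi>"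
proof -
  note iso' = iso[unfolded cp_algebra_iso_def]
  have bij: "bij_betw \<Phi> P.C Q.C"
    using iso' by blast
  define \<Psi> where "\<Psi> = inv_into P.C \<Phi>"
  have \<Psi>\<Phi>: "\<Psi> (\<Phi> X) = X" if "X \<in> P.C" for X
    using bij that by (simp add: \<Psi>_def bij_betw_inv_into_left)
  have \<Phi>\<Psi>: "\<Phi> (\<Psi> Y) = Y" if "Y \<in> Q.C" for Y
    using bij that by (simp add: \<Psi>_def bij_betw_inv_into_right)
  have \<Phi>C: "\<Phi> X \<in> Q.C" if "X \<in> P.C" for X
    using bij that by (rule bij_betwE[rule_format])
  have \<Psi>C: "\<Psi> Y \<in> P.C" if "Y \<in> Q.C" for Y
    using bij_betwE[OF bij_betw_inv_into[OF bij]] that by (simp add: \<Psi>_def)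
  interpret F: cp_colinear_map s \<Delta> \<epsilon> S sA act bact \<omega> \<sigma> \<Phi>
    using \<Phi>C iso' module_map comodule_map by unfold_locales blast+
  have sum_in: "tens_sum sA s [X, Y] \<in> P.C" if "X \<in> P.C" "Y \<in> P.C" for X Y
    using that by (metis P.cp_spaceE P.cls_T_in_cp_space T_add tens_sum_pair)
  have scale_in: "tens_scale sA s c X \<in> P.C" if "X \<in> P.C" for c X
    using that by (metis P.cp_spaceE P.cls_T_in_cp_space T_scl tens_scale_cls)
  interpret swapped: two_partial_actions s \<Delta> \<epsilon> S sA bact act \<sigma> \<omega>
    by unfold_locales
  interpret G: cp_linear_map s \<Delta> \<epsilon> S sA bact act \<sigma> \<omega> \<Psi>
  proof
    show "\<Psi> X \<in> P.C" if "X \<in> Q.C" for X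
      by (rule \<Psi>C[OF that])
    show "\<Psi> (tens_sum sA s [X, Y]) = tens_sum sA s [\<Psi> X, \<Psi> Y]" if "X \<in> Q.C" "Y \<in> Q.C" for X Y
      using F.add[of "\<Psi> X" "\<Psi> Y"] sum_in[of "\<Psi> X" "\<Psi> Y"] that
      by (metis \<Phi>\<Psi> \<Psi>\<Phi> \<Psi>C)
    show "\<Psi> (tens_scale sA s c X) = tens_scale sA s c (\<Psi> X)" if "X \<in> Q.C" for X c
      using F.scale[of "\<Psi> X" c] scale_in[of "\<Psi> X" c] that by (metis \<Phi>\<Psi> \<Psi>\<Phi> \<Psi>C)
  qed
  interpret G: cp_colinear_map s \<Delta> \<epsilon> S sA bact act \<sigma> \<omega> \<Psi>
  proof
    show "cp_module_map s \<Delta> sA bact \<sigma> act \<omega> \<Psi>"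
      unfolding cp_module_map_def
    proof (intro allI ballI)
      fix a Y
      assume Y: "Y \<in> Q.C"
      obtain p where p: "\<Psi> Y = cls N (T P.e p)"
        using \<Psi>C[OF Y] by (rule P.cp_spaceE)
      have "cp_mult s \<Delta> sA act \<omega> (cp_elem s \<Delta> sA act a 1) (\<Psi> Y) \<in> P.C"
        by (simp add: p P.cp_mult_left T_lmul[symmetric])
      then show "\<Psi> (cp_mult s \<Delta> sA bact \<sigma> (cp_elem s \<Delta> sA bact a 1) Y) =
          cp_mult s \<Delta> sA act \<omega> (cp_elem s \<Delta> sA act a 1) (\<Psi> Y)"
        using module_map \<Psi>C[OF Y] \<Phi>\<Psi>[OF Y] \<Psi>\<Phi> unfolding cp_module_map_def by metis
    qed
    show "cp_comodule_map s \<Delta> sA bact \<sigma> \<Psi>"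
      unfolding cp_comodule_map_def
    proof
      fix Y
      assume Y: "Y \<in> Q.C"
      define p where "p = formal_sum (pres2 sA s (\<Psi> Y))"
      have "cls N p = \<Psi> Y"
        unfolding p_def by (rule P.cls_pres2[OF \<Psi>C[OF Y]])
      then have "\<Psi> Y = cls N (T P.e p)"
        using P.T_e_cls[of p] \<Psi>C[OF Y] by simp
      then obtain Xs where Xs: "coaction s \<Delta> sA (\<Psi> Y) = join_tens s sA Xs" "fst ` set Xs \<subseteq> P.C"
        using P.coaction_join[of "pres2 sA s (\<Psi> Y)"] unfolding p_def by metis
      \<comment> \<open>Colinearity of the inverse: \<Phi> (x) I turns a presentation of the
        coaction of \<Psi> Y into one for Y, and \<Psi> applied to its entries restores the
        original.\<close>
      have "coaction s \<Delta> sA Y = join_tens s sA (map (apfst \<Phi>) Xs)"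
        using comodule_map \<Psi>C[OF Y] \<Phi>\<Psi>[OF Y] F.map_tens_id_join[OF Xs(2)] Xs(1)
        unfolding cp_comodule_map_def by metis
      moreover have "fst ` set (map (apfst \<Phi>) Xs) \<subseteq> Q.C"
        using Xs(2) \<Phi>C by auto
      moreover have "map (apfst \<Psi>) (map (apfst \<Phi>) Xs) = Xs"
        using Xs(2) \<Psi>\<Phi> by (auto intro!: map_idI)
      ultimately show
        "coaction s \<Delta> sA (\<Psi> Y) = map_tens_id s sA Q.C \<Psi> (coaction s \<Delta> sA Y)"
        by (simp add: G.map_tens_id_join Xs(1))
    qed
  qed
  define u where "u = F.coeff"
  define v where "v = G.coeff"
  have lin [simp]: "lin u" "lin v"
    unfolding u_def v_def by (rule F.lin_coeff G.lin_coeff)+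
  note [simp] = bil_lcnv bil_cnv2 bil_comp_mult lin_cnv
  have \<Phi>_eq: "\<Phi> (cls N (T P.e p)) = cls N (T u p)" for p
    unfolding u_def by (rule F.map_eq)
  have \<Psi>_eq: "\<Psi> (cls N (T Q.e p)) = cls N (T v p)" for p
    unfolding v_def by (rule G.map_eq)
  have eu: "cnv P.e u = u" and ue': "cnv u Q.e = u"
    unfolding u_def by (rule F.cnv_e_coeff F.cnv_coeff_e)+
  have e'v: "cnv Q.e v = v" and ve: "cnv v P.e = v"
    unfolding v_def by (rule G.cnv_e_coeff G.cnv_coeff_e)+
  \<comment> \<open>The source idempotent is absorbed on the left only; its centrality supplies the
    other half of (ii).\<close>
  have ue: "cnv u P.e = u"
    using P.e_central[of u] eu by simp
  have Tue': "cls N (T Q.e (T u p)) = cls N (T u p)" for p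
    by (simp add: T_T ue')
  have Tve: "cls N (T P.e (T v p)) = cls N (T v p)" for p
    by (simp add: T_T ve)
  \<comment> \<open>On T_e(1 (x) h) the composite \<Psi> \<Phi> is T_v T_u; \<open>ev\<close> reads
    off the coefficients.\<close>
  have uv: "cnv u v = P.e"
  proof
    fix h
    have "cls N (T P.e (frag_of (1, h))) = cls N (T v (T u (frag_of (1, h))))"
      using \<Psi>\<Phi>[OF P.cls_T_in_cp_space, of "frag_of (1, h)"]
      by (simp only: \<Phi>_eq \<Psi>_eq[symmetric] Tue')
    then show "cnv u v h = P.e h"
      using ev_cls[of "T P.e (frag_of (1, h))" "T (cnv u v) (frag_of (1, h))"]
      by (simp add: T_T del: T_frag) simp
  qed
  have vu: "cnv v u = Q.e"
  proof
    fix h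
    have "cls N (T Q.e (frag_of (1, h))) = cls N (T u (T v (frag_of (1, h))))"
      using \<Phi>\<Psi>[OF Q.cls_T_in_cp_space, of "frag_of (1, h)"]
      by (simp only: \<Psi>_eq \<Phi>_eq[symmetric] Tve)
    then show "cnv v u h = Q.e h"
      using ev_cls[of "T Q.e (frag_of (1, h))" "T (cnv v u) (frag_of (1, h))"]
      by (simp add: T_T del: T_frag) simp
  qed
  have u1: "u 1 = 1"
  proof -
    have "cls N (T u (frag_of (1, 1))) = cls N (T Q.e (frag_of (1, 1)))"
      using iso' by (simp only: P.cp_elem_T Q.cp_elem_T \<Phi>_eq)
    from ev_cls[OF this] show ?thesis
      by simp
  qed
  let ?U = "\<lambda>h k. u (h * k)"
  have bu: "lin (\<lambda>k. b * u k)" and be: "lin (\<lambda>k. b * P.e k)" for b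
    using linD[OF lin(1)] linD[OF P.lin_act] by (simp_all add: lin_def sA_simps distrib_left)
  note [simp] = bu be
  \<comment> \<open>Multiplicativity of \<Phi> on (1 # h)(b # k), reduced to coefficients by
    \<open>ev\<close>. The free b is what recovers the second action.\<close>
  have exchange: "cnv2 (\<lambda>h k. act h (b * P.e k)) (cnv2 \<omega> ?U) =
      lcnv u (cnv2 (\<lambda>h k. bact h (b * u k)) \<sigma>)" for b
  proof (intro ext)
    fix h k
    let ?F = "cnv2 (\<lambda>x y. act x (b * P.e y)) \<omega>"
    let ?p = "P.mul (tau P.e 1 h) (tau P.e b k)"
    have "\<Phi> (cls N ?p) = cls N (Q.mul (tau u 1 h) (tau u b k))"
    proof -
      have "\<Phi> (cp_mult s \<Delta> sA act \<omega> (cls N (T P.e (frag_of (1, h)))) (cls N (T P.e (frag_of (b, k))))) =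
        cp_mult s \<Delta> sA bact \<sigma> (\<Phi> (cls N (T P.e (frag_of (1, h))))) (\<Phi> (cls N (T P.e (frag_of (b, k)))))"
        using iso' P.cls_T_in_cp_space by blast
      then have "\<Phi> (cls N (P.mul (T P.e (frag_of (1, h))) (T P.e (frag_of (b, k))))) =
          cls N (Q.mul (T u (frag_of (1, h))) (T u (frag_of (b, k))))"
        by (simp only: \<Phi>_eq P.cp_mult_cls Q.cp_mult_cls)
      then show ?thesis
        by simp
    qed
    moreover have "\<Phi> (cls N ?p) = cls N (T u ?p)"
      using \<Phi>_eq[of ?p] P.T_e_cls[OF P.mul_in_cp_space] by simp
    moreover have "cls N (T u ?p) = cls N (pf (cnv2 (lcnv P.e ?F) ?U) 1 h k)"
    proof -
      have "cls N (T u ?p) = cls N (T u (pf (lcnv P.e ?F) 1 h k))"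
        by (intro T_cls P.mul_tau) simp_all
      then show ?thesis
        by (simp add: T_pf)
    qed
    ultimately have "cls N (pf (cnv2 (lcnv P.e ?F) ?U) 1 h k) =
        cls N (pf (lcnv u (cnv2 (\<lambda>h k. bact h (b * u k)) \<sigma>)) 1 h k)"
      by (simp add: Q.mul_tau)
    from ev_cls[OF this]
    have "cnv2 (lcnv P.e ?F) ?U h k = lcnv u (cnv2 (\<lambda>h k. bact h (b * u k)) \<sigma>) h k"
      by simp
    then show "cnv2 (\<lambda>h k. act h (b * P.e k)) (cnv2 \<omega> ?U) h k =
        lcnv u (cnv2 (\<lambda>h k. bact h (b * u k)) \<sigma>) h k"
      by (simp add: lcnv_cnv2 P.lcnv_e_act cnv2_assoc)
  qed
  \<comment> \<open>Read the exchange identity at k = 1, where the cocycles become e and e' and u(1)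
    = 1.\<close>
  have u_bact: "cnv u (\<lambda>h. bact h b) = cnv (\<lambda>h. act h b) u" for b
  proof
    fix h
    have "cnv2 (\<lambda>h k. act h (b * P.e k)) (cnv2 \<omega> ?U) h 1 = cnv (\<lambda>h. act h b) (cnv P.e u) h"
      by (simp add: cnv2_one_right cnv_sw P.cocycle_one_right)
    moreover have "lcnv u (cnv2 (\<lambda>h k. bact h (b * u k)) \<sigma>) h 1 =
        cnv u (cnv (\<lambda>h. bact h b) Q.e) h"
      by (simp add: cnv2_one_right lcnv_def cnv_sw Q.cocycle_one_right u1)
    ultimately show "cnv u (\<lambda>h. bact h b) h = cnv (\<lambda>h. act h b) u h"
      using exchange[of b] by (simp add: eu Q.cnv_act)
  qed
  have "(\<lambda>h. bact h a) = cnv v (cnv (\<lambda>h. act h a) u)" for a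
    by (simp add: u_bact[symmetric] cnv_assoc[symmetric] vu Q.cnv_act)
  moreover have "\<sigma> = lcnv v (cnv2 (\<lambda>h k. act h (v k)) (cnv2 \<omega> ?U))"
  proof -
    \<comment> \<open>The exchange identity at b = 1, whose factor h . e(k) is absorbed by the
      cocycle.\<close>
    have "cnv2 \<omega> ?U = cnv2 (\<lambda>h k. act h (P.e k)) (cnv2 \<omega> ?U)"
      by (simp add: cnv2_assoc[symmetric] P.cocycle_absorb_left)
    also have "\<dots> = lcnv u (cnv2 (\<lambda>h k. bact h (u k)) \<sigma>)"
      using exchange[of 1] by simp
    finally have *: "cnv2 \<omega> ?U = lcnv u (cnv2 (\<lambda>h k. bact h (u k)) \<sigma>)" .
    \<comment> \<open>Moving u to the left past h . v(k) changes the action and brings u next to the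
      outer v, where they cancel to e'.\<close>
    have "cnv2 (\<lambda>h k. act h (v k)) (lcnv u G) = lcnv u (cnv2 (\<lambda>h k. bact h (v k)) G)"
      if "bil G" for G
      using that rcnv_cnv2[of u "\<lambda>h k. act h (v k)" G]
      by (simp add: rcnv_act[OF u_bact, symmetric] lcnv_cnv2)
    then have "lcnv v (cnv2 (\<lambda>h k. act h (v k)) (cnv2 \<omega> ?U)) =
        lcnv v (lcnv u (cnv2 (\<lambda>h k. bact h (v k)) (cnv2 (\<lambda>h k. bact h (u k)) \<sigma>)))"
      unfolding * by simp
    also have "\<dots> = lcnv Q.e (cnv2 (\<lambda>h k. bact h (Q.e k)) \<sigma>)"
      by (simp add: lcnv_assoc[symmetric] vu cnv2_assoc[symmetric] Q.cnv2_act)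
    also have "\<dots> = cnv2 (\<lambda>h k. bact h (Q.e k)) \<sigma>"
      by (simp add: lcnv_cnv2 Q.lcnv_e_act)
    also have "\<dots> = \<sigma>"
      by (rule Q.cocycle_absorb_left)
    finally show ?thesis
      by simp
  qed
  ultimately have "twisting_pair s \<Delta> sA act \<omega> bact \<sigma> u v"
    unfolding twisting_pair_iff using lin uv ue eu by blast
  moreover have "twisting_formula s \<Delta> sA act bact u \<Phi>"
    unfolding twisting_formula_iff
  proof (intro allI)
    fix a h
    show "\<Phi> (cls N (tau P.e a h)) = cls N (T Q.e (tau u a h))"
      using \<Phi>_eq[of "frag_of (a, h)"] Tue'[of "frag_of (a, h)"] by simp
  qed
  ultimately show ?thesis
    by blast
qed

end

theorem theorem4p1:
  fixes s :: "'k::comm_ring_1 \<Rightarrow> 'h::{ring, monoid_mult} \<Rightarrow> 'h"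
    and \<Delta> :: "'h \<Rightarrow> ('h, 'h) tensor2" and \<epsilon> :: "'h \<Rightarrow> 'k" and S :: "'h \<Rightarrow> 'h"
    and sA :: "'k \<Rightarrow> 'a::{ring, monoid_mult} \<Rightarrow> 'a"
    and act bact :: "'h \<Rightarrow> 'a \<Rightarrow> 'a" and \<omega> \<sigma> :: "'h \<Rightarrow> 'h \<Rightarrow> 'a"
  assumes "unital_algebra sA" and "hopf_algebra s \<Delta> \<epsilon> S"
    and "symmetric_twisted_partial_action s \<Delta> \<epsilon> S sA act \<omega>"
    and "symmetric_twisted_partial_action s \<Delta> \<epsilon> S sA bact \<sigma>"
  shows "(\<forall>\<Phi>. cp_algebra_iso s \<Delta> sA act \<omega> bact \<sigma> \<Phi> \<and>
              cp_module_map s \<Delta> sA act \<omega> bact \<sigma> \<Phi> \<and>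
              cp_comodule_map s \<Delta> sA act \<omega> \<Phi> \<longrightarrow>
            (\<exists>u v. twisting_pair s \<Delta> sA act \<omega> bact \<sigma> u v \<and>
                   twisting_formula s \<Delta> sA act bact u \<Phi>)) \<and>
         (\<forall>u v. twisting_pair s \<Delta> sA act \<omega> bact \<sigma> u v \<and> u 1 = 1 \<and> v 1 = 1 \<longrightarrow>
            (\<exists>\<Phi>. twisting_formula s \<Delta> sA act bact u \<Phi> \<and>
                  cp_algebra_iso s \<Delta> sA act \<omega> bact \<sigma> \<Phi>))"
proof -
  interpret two_partial_actions s \<Delta> \<epsilon> S sA act bact \<omega> \<sigma>
    using assms by (intro two_partial_actions.intro hopf_pair.intro)
  show ?thesis
    using iso_imp_twisting_pair twisting_pair_imp_iso by blast
qed

end
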